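(* Suppose $\eta>0$ (duality condition). If $\beta>\max\left\{2\frac{\omega_{\max}}{b_{\min}},\,2\frac{\omega_{\max}^\flat}{b_{\min}^\flat}\right\}$, then there exist unique invariant subspaces $H_{\ell\ell,0}(\beta)$, $H_{\ell\ell,1}(\beta)$ of $A(\beta)$ with the properties (i) $H_{\ell\ell}(\beta)=H_{\ell\ell,0}(\beta)\oplus H_{\ell\ell,1}(\beta)$; (ii) $\sigma\big(A(\beta)|_{H_{\ell\ell,0}(\beta)}\big)=\sigma(A(\beta))\cap\{\zeta:|\zeta|<\omega_{\min}\}$; (iii) $\sigma\big(A(\beta)|_{H_{\ell\ell,1}(\beta)}\big)=\sigma(A(\beta))\cap\{\zeta:\omega_{\min}\le|\zeta|\le\omega_{\max}\}$. Furthermore, $\dim H_{\ell\ell,0}(\beta)=N_R$ and $\dim H_{\ell\ell,1}(\beta)=2N-2N_R$. Moreover, $$\sigma\big(A(\beta)|_{H_{\ell\ell,0}(\beta)}\big)=-\overline{\sigma\big(A(\beta)|_{H_{\ell\ell,0}(\beta)}\big)}=-\sigma\big(A^\flat(\beta)|_{H^\flat_{h\ell}(\beta)}\big)^{-1},$$ $$\sigma\big(A(\beta)|_{H_{h\ell}(\beta)}\big)=-\overline{\sigma\big(A(\beta)|_{H_{h\ell}(\beta)}\big)}=-\sigma\big(A^\flat(\beta)|_{H^\flat_{\ell\ell,0}(\beta)}\big)^{-1},$$ $$\sigma\big(A(\beta)|_{H_{\ell\ell,1}(\beta)}\big)=-\overline{\sigma\big(A(\beta)|_{H_{\ell\ell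,1}(\beta)}\big)}=-\sigma\big(A^\flat(\beta)|_{H^\flat_{\ell\ell,1}(\beta)}\big)^{-1}.$$
   Context: Setting. $N\ge 1$; $\alpha,\eta,\theta,R$ are real $N\times N$ matrices with $\alpha^{\mathrm T}=\alpha>0$, $\eta^{\mathrm T}=\eta\ge0$, $\theta^{\mathrm T}=-\theta$, $R^{\mathrm T}=R\ge0$, and $N_R=\operatorname{rank}R>0$; $\beta\ge0$. $\sqrt{\cdot}$ denotes the positive semidefinite square root. On $H=\mathbb C^{2N}=\mathbb C^N\oplus\mathbb C^N$ set $$\Omega=\begin{bmatrix}-2\mathrm i\sqrt\alpha^{-1}\theta\sqrt\alpha^{-1} & -\mathrm i\Phi^{\mathrm T}\\ \mathrm i\Phi&0\end{bmatrix},\quad \Phi=\sqrt\eta\sqrt\alpha^{-1},\quad B=\begin{bmatrix}\sqrt\alpha^{-1}R\sqrt\alpha^{-1}&0\\0&0\end{bmatrix},\quad A(\beta)=\Omega-\mathrm i\beta B .$$ $\Omega$ is Hermitian, $B\ge0$, $\operatorname{rank}B=N_R$. $\sigma(\cdot)$ is the spectrum (empty for the operator on $\{0\}$). For a set $S\subseteq\mathbb C$: $-\overline S=\{-\overline\zeta:\zeta\in S\}$ and, if $0\notin S$, $-S^{-1}=\{-\zeta^{-1}:\zeta\in S\}$. $\omega_{\max}$ is the largest eigenvalue of $\Omega$ ($=\|\Omega\|$); $\omega_{\min}=\min|\sigma(\Omega)|$, which when $\eta>0$ is the smallest positive eigenvalue of $\Omega$; $b_{\min}$ is the smallest nonzero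 eigenvalue of $B$ (equivalently of $\alpha^{-1}R$); $0=b_0<b_1\le\dots\le b_{N_R}$ are the eigenvalue $0$ and the nonzero eigenvalues of $B$ (with multiplicity). High-loss/low-loss subspaces (known): let $D_j(\beta)=\{\zeta:|\zeta+\mathrm i\beta b_j|\le\omega_{\max}\}$, $\sigma_0(A(\beta))=\sigma(A(\beta))\cap D_0(\beta)$, $\sigma_1(A(\beta))=\sigma(A(\beta))\cap\bigcup_{j=1}^{N_R}D_j(\beta)$. If $\beta>2\omega_{\max}/b_{\min}$, then $\sigma(A(\beta))$ is the disjoint union of $\sigma_0(A(\beta))$ and $\sigma_1(A(\beta))$, and $H_{\ell\ell}(\beta)$, $H_{h\ell}(\beta)$ denote the unique invariant subspaces of $A(\beta)$ with $H=H_{h\ell}(\beta)\oplus H_{\ell\ell}(\beta)$, $\sigma(A(\beta)|_{H_{\ell\ell}(\beta)})=\sigma_0(A(\beta))$, $\sigma(A(\beta)|_{H_{h\ell}(\beta)})=\sigma_1(A(\beta))$; $\dim H_{h\ell}(\beta)=N_R$, $\dim H_{\ell\ell}(\beta)=2N-N_R$. Dual objects: when $\eta>0$, any object with superscript $\flat$ ($A^\flat,\Omega^\flat,B^\flat,\omega_{\max}^\flat,\omega_{\min}^\flat,b_{\min}^\flat,H_{h\ell}^\flat,H_{\ell\ell,0}^\flat,H_{\ell\ell,1}^\flat$) is defined exactly as the one without it but with $\alpha$ and $\eta$ interchanged. *)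

theory Defs
  imports "HOL-Analysis.Analysis"
begin

definition pos_semidef :: "real^'n^'n \<Rightarrow> bool" where
  "pos_semidef M \<longleftrightarrow> transpose M = M \<and> (\<forall>x. 0 \<le> x \<bullet> (M *v x))"

definition pos_def :: "real^'n^'n \<Rightarrow> bool" where
  "pos_def M \<longleftrightarrow> transpose M = M \<and> (\<forall>x. x \<noteq> 0 \<longrightarrow> 0 < x \<bullet> (M *v x))"

definition psd_sqrt :: "real^'n^'n \<Rightarrow> real^'n^'n" where
  "psd_sqrt M = (THE S. pos_semidef S \<and> S ** S = M)"

definition block_matrix ::
  "'a^'n^'n \<Rightarrow> 'a^'m^'n \<Rightarrow> 'a^'n^'m \<Rightarrow> 'a^'m^'m \<Rightarrow> 'a^('n + 'm)^('n + 'm)" where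
  "block_matrix P Q S T = (\<chi> i j. case i of
      Inl k \<Rightarrow> (case j of Inl l \<Rightarrow> P $ k $ l | Inr l \<Rightarrow> Q $ k $ l)
    | Inr k \<Rightarrow> (case j of Inl l \<Rightarrow> S $ k $ l | Inr l \<Rightarrow> T $ k $ l))"

abbreviation cmat :: "real^'n^'m \<Rightarrow> complex^'n^'m" where
  "cmat \<equiv> map_matrix complex_of_real"

definition invariant_subspace :: "complex^'n^'n \<Rightarrow> (complex^'n) set \<Rightarrow> bool" where
  "invariant_subspace A V \<longleftrightarrow> vec.subspace V \<and> (\<forall>x\<in>V. A *v x \<in> V)"

definition direct_sum ::
  "(complex^'n) set \<Rightarrow> (complex^'n) set \<Rightarrow> (complex^'n) set \<Rightarrow> bool" where
  "direct_sum W U V \<longleftrightarrow> W = {u + v | u v. u \<in> U \<and> v \<in> V} \<and> U \<inter> V = {0}"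

definition spectrum_on :: "complex^'n^'n \<Rightarrow> (complex^'n) set \<Rightarrow> complex set" where
  "spectrum_on A V = {z. \<not> bij_betw (\<lambda>x. A *v x - z *s x) V V}"

abbreviation spectrum :: "complex^'n^'n \<Rightarrow> complex set" where
  "spectrum A \<equiv> spectrum_on A UNIV"

text \<open>On a finite-dimensional space the spectrum consists of the eigenvalues.\<close>

lemma spectrum_on_eq_eigenvalues:
  fixes A :: "complex^'n^'n"
  assumes "invariant_subspace A V"
  shows "spectrum_on A V = {z. \<exists>v\<in>V. v \<noteq> 0 \<and> A *v v = z *s v}"
proof -
  have sub: "vec.subspace V" and inv: "\<And>x. x \<in> V \<Longrightarrow> A *v x \<in> V"
    using assms by (auto simp: invariant_subspace_def)
  have "bij_betw (\<lambda>x. A *v x - z *s x) V V \<longleftrightarrow> (\<forall>v\<in>V. A *v v = z *s v \<longrightarrow> v = 0)" for z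
  proof -
    let ?f = "\<lambda>x. A *v x - z *s x"
    have "mat z *v x = z *s x" for x :: "complex^'n"
      by (simp add: vec_eq_iff matrix_vector_mult_def mat_def if_distrib if_distribR
          cong: if_cong)
    then have eq: "?f = (*v) (A - mat z)"
      by (simp add: fun_eq_iff matrix_vector_mult_diff_rdistrib)
    have lin: "Vector_Spaces.linear (*s) (*s) ?f"
      unfolding eq by (rule matrix_vector_mul_linear_gen)
    have im: "?f ` V \<subseteq> V"
      using sub inv by (auto intro: vec.subspace_diff vec.subspace_scale)
    have span: "vec.span V = V"
      using sub by (simp add: vec.span_eq_iff)
    have inj: "inj_on ?f V \<longleftrightarrow> (\<forall>v\<in>V. ?f v = 0 \<longrightarrow> v = 0)"
      using vec.linear_inj_on_iff_eq_0[OF lin sub] by simp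
    have "?f ` V = V" if "inj_on ?f V"
    proof -
      have "vec.dim (?f ` V) = vec.dim V"
        using vec.dim_image_eq[OF lin, of V] that unfolding span .
      moreover have "vec.subspace (?f ` V)"
        using vec.linear_subspace_image[OF lin sub] .
      ultimately show ?thesis
        using vec.subspace_dim_equal[of "?f ` V" V] sub im by simp
    qed
    then show ?thesis
      using inj by (auto simp: bij_betw_def)
  qed
  then show ?thesis
    by (auto simp: spectrum_on_def)
qed

text \<open>The order of the first two arguments matters below: the dual objects are obtained by
  exchanging \<open>\<alpha>\<close> and \<open>\<eta>\<close>, e.g. \<open>Omega \<eta> \<alpha> \<theta>\<close> and \<open>Bmat \<eta> R\<close>.\<close>

definition Phi :: "real^'n^'n \<Rightarrow> real^'n^'n \<Rightarrow> real^'n^'n" where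
  "Phi \<alpha> \<eta> = psd_sqrt \<eta> ** matrix_inv (psd_sqrt \<alpha>)"

definition Omega :: "real^'n^'n \<Rightarrow> real^'n^'n \<Rightarrow> real^'n^'n \<Rightarrow> complex^('n + 'n)^('n + 'n)" where
  "Omega \<alpha> \<eta> \<theta> = block_matrix
     (map_matrix ((*) (- 2 * \<i>)) (cmat (matrix_inv (psd_sqrt \<alpha>) ** \<theta> ** matrix_inv (psd_sqrt \<alpha>))))
     (map_matrix ((*) (- \<i>)) (cmat (transpose (Phi \<alpha> \<eta>))))
     (map_matrix ((*) \<i>) (cmat (Phi \<alpha> \<eta>)))
     0"

definition Bmat :: "real^'n^'n \<Rightarrow> real^'n^'n \<Rightarrow> complex^('n + 'n)^('n + 'n)" where
  "Bmat \<alpha> R = block_matrix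
     (cmat (matrix_inv (psd_sqrt \<alpha>) ** R ** matrix_inv (psd_sqrt \<alpha>))) 0 0 0"

definition Amat :: "real^'n^'n \<Rightarrow> real^'n^'n \<Rightarrow> real^'n^'n \<Rightarrow> real^'n^'n \<Rightarrow> real \<Rightarrow>
    complex^('n + 'n)^('n + 'n)" where
  "Amat \<alpha> \<eta> \<theta> R \<beta> = Omega \<alpha> \<eta> \<theta> - map_matrix ((*) (\<i> * of_real \<beta>)) (Bmat \<alpha> R)"

definition omega_max :: "real^'n^'n \<Rightarrow> real^'n^'n \<Rightarrow> real^'n^'n \<Rightarrow> real" where
  "omega_max \<alpha> \<eta> \<theta> = Max {w. complex_of_real w \<in> spectrum (Omega \<alpha> \<eta> \<theta>)}"

definition omega_min :: "real^'n^'n \<Rightarrow> real^'n^'n \<Rightarrow> real^'n^'n \<Rightarrow> real" where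
  "omega_min \<alpha> \<eta> \<theta> = Min (cmod ` spectrum (Omega \<alpha> \<eta> \<theta>))"

definition nonzero_losses :: "real^'n^'n \<Rightarrow> real^'n^'n \<Rightarrow> real set" where
  "nonzero_losses \<alpha> R = {b. b \<noteq> 0 \<and> complex_of_real b \<in> spectrum (Bmat \<alpha> R)}"

definition b_min :: "real^'n^'n \<Rightarrow> real^'n^'n \<Rightarrow> real" where
  "b_min \<alpha> R = Min (nonzero_losses \<alpha> R)"

definition loss_disc :: "real^'n^'n \<Rightarrow> real^'n^'n \<Rightarrow> real^'n^'n \<Rightarrow> real \<Rightarrow> real \<Rightarrow> complex set" where
  "loss_disc \<alpha> \<eta> \<theta> \<beta> b = {z. cmod (z + \<i> * of_real \<beta> * of_real b) \<le> omega_max \<alpha> \<eta> \<theta>}"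

definition sigma0 ::
  "real^'n^'n \<Rightarrow> real^'n^'n \<Rightarrow> real^'n^'n \<Rightarrow> real^'n^'n \<Rightarrow> real \<Rightarrow> complex set" where
  "sigma0 \<alpha> \<eta> \<theta> R \<beta> = spectrum (Amat \<alpha> \<eta> \<theta> R \<beta>) \<inter> loss_disc \<alpha> \<eta> \<theta> \<beta> 0"

text \<open>The discs depend only on their \<open>b\<close>, so the union may range over the distinct nonzero
  eigenvalues of \<open>B\<close>; counting multiplicities only repeats members of the union.\<close>

definition sigma1 ::
  "real^'n^'n \<Rightarrow> real^'n^'n \<Rightarrow> real^'n^'n \<Rightarrow> real^'n^'n \<Rightarrow> real \<Rightarrow> complex set" where
  "sigma1 \<alpha> \<eta> \<theta> R \<beta> =
     spectrum (Amat \<alpha> \<eta> \<theta> R \<beta>) \<inter> (\<Union>b\<in>nonzero_losses \<alpha> R. loss_disc \<alpha> \<eta> \<theta> \<beta> b)"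

definition is_loss_split :: "real^'n^'n \<Rightarrow> real^'n^'n \<Rightarrow> real^'n^'n \<Rightarrow> real^'n^'n \<Rightarrow> real \<Rightarrow>
    (complex^('n + 'n)) set \<Rightarrow> (complex^('n + 'n)) set \<Rightarrow> bool" where
  "is_loss_split \<alpha> \<eta> \<theta> R \<beta> U V \<longleftrightarrow>
     invariant_subspace (Amat \<alpha> \<eta> \<theta> R \<beta>) U \<and>
     invariant_subspace (Amat \<alpha> \<eta> \<theta> R \<beta>) V \<and>
     direct_sum UNIV U V \<and>
     spectrum_on (Amat \<alpha> \<eta> \<theta> R \<beta>) V = sigma0 \<alpha> \<eta> \<theta> R \<beta> \<and>
     spectrum_on (Amat \<alpha> \<eta> \<theta> R \<beta>) U = sigma1 \<alpha> \<eta> \<theta> R \<beta>"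

definition H_hl :: "real^'n^'n \<Rightarrow> real^'n^'n \<Rightarrow> real^'n^'n \<Rightarrow> real^'n^'n \<Rightarrow> real \<Rightarrow>
    (complex^('n + 'n)) set" where
  "H_hl \<alpha> \<eta> \<theta> R \<beta> = fst (THE (U, V). is_loss_split \<alpha> \<eta> \<theta> R \<beta> U V)"

definition H_ll :: "real^'n^'n \<Rightarrow> real^'n^'n \<Rightarrow> real^'n^'n \<Rightarrow> real^'n^'n \<Rightarrow> real \<Rightarrow>
    (complex^('n + 'n)) set" where
  "H_ll \<alpha> \<eta> \<theta> R \<beta> = snd (THE (U, V). is_loss_split \<alpha> \<eta> \<theta> R \<beta> U V)"

definition is_low_loss_split :: "real^'n^'n \<Rightarrow> real^'n^'n \<Rightarrow> real^'n^'n \<Rightarrow> real^'n^'n \<Rightarrow> real \<Rightarrow>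
    (complex^('n + 'n)) set \<Rightarrow> (complex^('n + 'n)) set \<Rightarrow> bool" where
  "is_low_loss_split \<alpha> \<eta> \<theta> R \<beta> U V \<longleftrightarrow>
     invariant_subspace (Amat \<alpha> \<eta> \<theta> R \<beta>) U \<and>
     invariant_subspace (Amat \<alpha> \<eta> \<theta> R \<beta>) V \<and>
     direct_sum (H_ll \<alpha> \<eta> \<theta> R \<beta>) U V \<and>
     spectrum_on (Amat \<alpha> \<eta> \<theta> R \<beta>) U =
       spectrum (Amat \<alpha> \<eta> \<theta> R \<beta>) \<inter> {z. cmod z < omega_min \<alpha> \<eta> \<theta>} \<and>
     spectrum_on (Amat \<alpha> \<eta> \<theta> R \<beta>) V =
       spectrum (Amat \<alpha> \<eta> \<theta> R \<beta>) \<inter>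
         {z. omega_min \<alpha> \<eta> \<theta> \<le> cmod z \<and> cmod z \<le> omega_max \<alpha> \<eta> \<theta>}"

definition H_ll0 :: "real^'n^'n \<Rightarrow> real^'n^'n \<Rightarrow> real^'n^'n \<Rightarrow> real^'n^'n \<Rightarrow> real \<Rightarrow>
    (complex^('n + 'n)) set" where
  "H_ll0 \<alpha> \<eta> \<theta> R \<beta> = fst (THE (U, V). is_low_loss_split \<alpha> \<eta> \<theta> R \<beta> U V)"

definition H_ll1 :: "real^'n^'n \<Rightarrow> real^'n^'n \<Rightarrow> real^'n^'n \<Rightarrow> real^'n^'n \<Rightarrow> real \<Rightarrow>
    (complex^('n + 'n)) set" where
  "H_ll1 \<alpha> \<eta> \<theta> R \<beta> = snd (THE (U, V). is_low_loss_split \<alpha> \<eta> \<theta> R \<beta> U V)"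

definition neg_cnj :: "complex set \<Rightarrow> complex set" where
  "neg_cnj S = (\<lambda>z. - cnj z) ` S"

text \<open>Only meaningful for \<open>0 \<notin> S\<close>, since \<open>inverse 0 = 0\<close>.\<close>

definition neg_inv :: "complex set \<Rightarrow> complex set" where
  "neg_inv S = (\<lambda>z. - inverse z) ` S"

end

theory Submission
  imports Defs "HOL-Computational_Algebra.Fundamental_Theorem_Algebra"
begin

text \<open>
  Exchanging \<open>\<alpha>\<close> and \<open>\<eta>\<close> amounts to inverting the matrix: with \<open>P\<close> the exchange of the two blocks
  of \<open>\<complex>\<^sup>N \<oplus> \<complex>\<^sup>N\<close>, one has \<open>A\<^sup>\<flat>(\<beta>) = - P A(\<beta>)\<^sup>-\<^sup>1 P\<close>, in particular \<open>\<Omega>\<^sup>\<flat> = - P \<Omega>\<^sup>-\<^sup>1 P\<close> and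
  \<open>\<omega>\<^sub>m\<^sub>i\<^sub>n = 1 / \<omega>\<^sup>\<flat>\<^sub>m\<^sub>a\<^sub>x\<close>. Hence the splitting of the spectrum of \<open>A\<close> at modulus \<open>\<omega>\<^sub>m\<^sub>i\<^sub>n\<close> is the
  image under \<open>\<zeta> \<mapsto> - 1 / \<zeta>\<close> of the high-loss/low-loss splitting of \<open>A\<^sup>\<flat>\<close>, and \<open>P\<close> carries the high-loss
  subspace of \<open>A\<^sup>\<flat>\<close> to the subspace of \<open>A\<close> belonging to \<open>|\<zeta>| < \<omega>\<^sub>m\<^sub>i\<^sub>n\<close>. The high-loss subspace has
  dimension \<open>N\<^sub>R\<close> because \<open>A / c\<close>, with \<open>c = \<beta> b\<^sub>m\<^sub>i\<^sub>n / 2\<close> in the spectral gap, strictly increases an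
  indefinite form that is positive on the range of \<open>B\<close> and negative on its kernel: this form is negative
  on the invariant subspace belonging to \<open>|\<zeta>| < c\<close> and positive on the one belonging to \<open>|\<zeta>| > c\<close>.
  The symmetry under \<open>\<zeta> \<mapsto> - \<zeta>\<^sup>*\<close> holds since \<open>\<i> A\<close> is real.
\<close>

section \<open>Generalised eigenspaces\<close>

text \<open>The sum of the generalised eigenspaces of \<open>A\<close> for the eigenvalues in
  \<open>S\<close>: a vector belongs to it iff some product of factors \<open>A - z\<close> with
  \<open>z\<close> in \<open>S\<close> annihilates it. Induction peels off one factor at a time, so
  multiplicities, Jordan chains and spectral projections never appear.\<close>

inductive_set gen_eigenspace :: "complex^'n^'n \<Rightarrow> complex set \<Rightarrow> (complex^'n) set"
  for A S where
  zero: "0 \<in> gen_eigenspace A S"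
| step: "z \<in> S \<Longrightarrow> A *v x - z *s x \<in> gen_eigenspace A S \<Longrightarrow> x \<in> gen_eigenspace A S"

lemma gen_eigenspace_mult: "x \<in> gen_eigenspace A S \<Longrightarrow> A *v x \<in> gen_eigenspace A S"
proof (induction rule: gen_eigenspace.induct)
  case zero
  show ?case by (simp add: gen_eigenspace.zero)
next
  case (step z x)
  have "A *v (A *v x) - z *s (A *v x) = A *v (A *v x - z *s x)"
    by (simp add: vec.diff vec.scale)
  with step show ?case by (metis gen_eigenspace.step)
qed

lemma gen_eigenspace_scale: "x \<in> gen_eigenspace A S \<Longrightarrow> c *s x \<in> gen_eigenspace A S"
proof (induction rule: gen_eigenspace.induct)
  case zero
  show ?case by (simp add: gen_eigenspace.zero)
next
  case (step z x)
  have "A *v (c *s x) - z *s (c *s x) = c *s (A *v x - z *s x)"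
    by (simp add: vec.scale vector_ssub_ldistrib vector_smult_assoc mult.commute)
  with step show ?case by (metis gen_eigenspace.step)
qed

text \<open>The factors \<open>A - z\<close> and \<open>A - w\<close> commute. Here \<open>z\<close>
  may lie outside \<open>S\<close>, which matters when a factor peeled off for one set acts on the
  subspace of another.\<close>

lemma gen_eigenspace_shift:
  "x \<in> gen_eigenspace A S \<Longrightarrow> A *v x - z *s x \<in> gen_eigenspace A S"
proof (induction rule: gen_eigenspace.induct)
  case zero
  show ?case by (simp add: gen_eigenspace.zero)
next
  case (step w x)
  have "A *v (A *v x - z *s x) - w *s (A *v x - z *s x) =
      A *v (A *v x - w *s x) - z *s (A *v x - w *s x)"
    by (simp add: vec.diff vec.scale vector_ssub_ldistrib vector_smult_assoc mult.commute)
  with step show ?case by (metis gen_eigenspace.step)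
qed

lemma gen_eigenspace_add:
  "x \<in> gen_eigenspace A S \<Longrightarrow> y \<in> gen_eigenspace A S \<Longrightarrow> x + y \<in> gen_eigenspace A S"
proof (induction arbitrary: y rule: gen_eigenspace.induct)
  case zero
  then show ?case by simp
next
  case (step z x)
  have "A *v (x + y) - z *s (x + y) = (A *v x - z *s x) + (A *v y - z *s y)"
    by (simp add: vec.add vector_add_ldistrib)
  with step gen_eigenspace_shift[of y A S z] show ?case by (metis gen_eigenspace.step)
qed

lemma invariant_gen_eigenspace: "invariant_subspace A (gen_eigenspace A S)"
  by (simp add: invariant_subspace_def vec.subspace_def gen_eigenspace.zero gen_eigenspace_add
      gen_eigenspace_scale gen_eigenspace_mult)

lemma subspace_gen_eigenspace: "vec.subspace (gen_eigenspace A S)"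
  using invariant_gen_eigenspace by (auto simp: invariant_subspace_def)

lemma gen_eigenspace_mono: "S \<subseteq> T \<Longrightarrow> gen_eigenspace A S \<subseteq> gen_eigenspace A T"
proof
  fix x assume "S \<subseteq> T" "x \<in> gen_eigenspace A S"
  show "x \<in> gen_eigenspace A T"
    using \<open>x \<in> gen_eigenspace A S\<close>
    by (induction rule: gen_eigenspace.induct) (use \<open>S \<subseteq> T\<close> in \<open>blast intro: gen_eigenspace.intros\<close>)+
qed

text \<open>A factor \<open>A - w\<close> only rescales the eigenvector, by \<open>z - w\<close>.
  Peeling off factors must end at 0, so one of them has \<open>w = z\<close>.\<close>

lemma eigenvalue_gen_eigenspace:
  assumes "v \<in> gen_eigenspace A S" "v \<noteq> 0" "A *v v = z *s v"
  shows "z \<in> S"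
  using assms
proof (induction rule: gen_eigenspace.induct)
  case zero
  then show ?case by simp
next
  case (step w x)
  have eq: "A *v x - w *s x = (z - w) *s x"
    using step by (simp add: vec.scale_left_diff_distrib)
  show ?case
  proof (cases "z = w")
    case True
    with step show ?thesis by simp
  next
    case False
    then have "(z - w) *s x \<noteq> 0"
      using step.prems by simp
    moreover have "A *v ((z - w) *s x) = z *s ((z - w) *s x)"
      by (simp only: vec.scale step.prems vector_smult_assoc mult.commute)
    ultimately show ?thesis using step.IH eq by simp
  qed
qed

lemma eigenvector_in_gen_eigenspace:
  assumes "A *v v = z *s v" "z \<in> S"
  shows "v \<in> gen_eigenspace A S"
  by (rule gen_eigenspace.step[OF assms(2)]) (simp add: assms(1) gen_eigenspace.zero)

text \<open>Turns claims about spectra of restrictions into claims about subsets of the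
  plane.\<close>

lemma spectrum_on_gen_eigenspace: "spectrum_on A (gen_eigenspace A S) = spectrum A \<inter> S"
proof -
  have "invariant_subspace A UNIV"
    by (simp add: invariant_subspace_def)
  then show ?thesis
    unfolding spectrum_on_eq_eigenvalues[OF invariant_gen_eigenspace]
    by (subst spectrum_on_eq_eigenvalues)
      (auto dest: eigenvalue_gen_eigenspace intro: eigenvector_in_gen_eigenspace)
qed

lemma spectrum_eq: "spectrum A = {z. \<exists>v. v \<noteq> 0 \<and> A *v v = z *s v}"
  by (subst spectrum_on_eq_eigenvalues) (auto simp: invariant_subspace_def)

section \<open>Polynomials in a matrix and annihilation of vectors\<close>

definition poly_apply :: "complex poly \<Rightarrow> complex^'n^'n \<Rightarrow> complex^'n \<Rightarrow> complex^'n" where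
  "poly_apply p A = fold_coeffs (\<lambda>a f x. a *s x + f (A *v x)) p (\<lambda>x. 0)"

lemma poly_apply_0 [simp]: "poly_apply 0 A x = 0"
  by (simp add: poly_apply_def)

lemma poly_apply_pCons [simp]:
  "poly_apply (pCons a p) A x = a *s x + poly_apply p A (A *v x)"
  by (cases "a = 0 \<and> p = 0") (auto simp: poly_apply_def)

lemma poly_apply_add_left: "poly_apply (p + q) A x = poly_apply p A x + poly_apply q A x"
  by (induction p q arbitrary: x rule: poly_induct2)
    (simp_all add: vec.scale_left_distrib)

lemma poly_apply_smult: "poly_apply (smult c p) A x = c *s poly_apply p A x"
  by (induction p arbitrary: x) (simp_all add: vector_add_ldistrib vector_smult_assoc)

lemma poly_apply_add: "poly_apply p A (x + y) = poly_apply p A x + poly_apply p A y"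
  by (induction p arbitrary: x y) (simp_all add: vec.add vector_add_ldistrib)

lemma poly_apply_scale: "poly_apply p A (c *s x) = c *s poly_apply p A x"
  by (induction p arbitrary: x)
    (simp_all add: vec.scale vector_add_ldistrib vector_smult_assoc mult.commute)

lemma poly_apply_linear_factor:
  "poly_apply ([:- z, 1:] * q) A x = poly_apply q A (A *v x - z *s x)"
proof -
  have "A *v x - z *s x = A *v x + (- z) *s x"
    by simp
  moreover have "[:- z, 1:] * q = pCons 0 q + smult (- z) q"
    by simp
  ultimately show ?thesis
    by (simp only: poly_apply_add_left poly_apply_smult poly_apply_add poly_apply_scale) simp
qed

text \<open>Over the complex numbers a nonconstant \<open>p\<close> splits off a root
  \<open>z\<close>. The cofactor, of smaller degree, annihilates \<open>(A - z) x\<close>, and one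
  \<open>step\<close> of the inductive definition returns to \<open>x\<close>.\<close>

lemma gen_eigenspace_if_poly_apply_eq_0:
  "p \<noteq> 0 \<Longrightarrow> poly_apply p A x = 0 \<Longrightarrow> x \<in> gen_eigenspace A UNIV"
proof (induction "degree p" arbitrary: p x)
  case 0
  then obtain c where "p = [:c:]" "c \<noteq> 0"
    by (metis degree_0_id degree_eq_zeroE pCons_0_0)
  with 0 have "x = 0" by simp
  then show ?case by (simp add: gen_eigenspace.zero)
next
  case (Suc n)
  then obtain z where "poly p z = 0"
    using fundamental_theorem_of_algebra_alt[of p] by (metis degree_pCons_0 nat.distinct(1))
  then obtain q where q: "p = [:- z, 1:] * q"
    by (auto simp: poly_eq_0_iff_dvd)
  with Suc.prems have "q \<noteq> 0" by auto
  then have "degree p = Suc (degree q)"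
    unfolding q by (subst degree_mult_eq) auto
  with Suc have "A *v x - z *s x \<in> gen_eigenspace A UNIV"
    using \<open>q \<noteq> 0\<close> by (metis diff_Suc_1 poly_apply_linear_factor q)
  then show ?case by (rule gen_eigenspace.step[OF UNIV_I])
qed

lemma poly_apply_sum: "poly_apply (\<Sum>i\<in>I. p i) A x = (\<Sum>i\<in>I. poly_apply (p i) A x)"
  by (induction I rule: infinite_finite_induct) (simp_all add: poly_apply_add_left)

lemma poly_apply_monom: "poly_apply (monom c k) A x = c *s (((*v) A ^^ k) x)"
  by (induction k arbitrary: x) (simp_all add: monom_0 monom_Suc funpow_swap1)

text \<open>The iterates \<open>x, A x, A^2 x, ...\<close> up to the power \<open>CARD('n)\<close>
  are too many to be independent; a linear relation among them is a polynomial.\<close>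

lemma annihilating_poly:
  fixes A :: "complex^'n^'n"
  obtains p where "p \<noteq> 0" "poly_apply p A x = 0"
\<comment> \<open>Dependence is a property of sets, so repeated iterates would go unnoticed. They
  are treated apart, by the difference of two monomials.\<close>
proof (cases "inj (\<lambda>k. ((*v) A ^^ k) x)")
  case True
  define f where "f = (\<lambda>k. ((*v) A ^^ k) x)"
  define I where "I = {..CARD('n)}"
  have inj: "inj_on f I"
    using True by (auto simp: f_def inj_on_def)
  have "card (f ` I) = Suc CARD('n)"
    using card_image[OF inj] by (simp add: I_def)
  then have "vec.dependent (f ` I)"
    by (metis not_less_eq_eq order_refl vec.independent_card_le_dim subset_UNIV vec_dim_card)
  then obtain u v where u: "v \<in> f ` I" "u v \<noteq> 0" "(\<Sum>v\<in>f ` I. u v *s v) = 0"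
    using vec.dependent_finite[of "f ` I"] by (auto simp: I_def)
  define p where "p = (\<Sum>k\<in>I. monom (u (f k)) k)"
  obtain k where k: "k \<in> I" "v = f k" using u by auto
  have "coeff p k = u (f k)"
    unfolding p_def coeff_sum using k by (simp add: I_def)
  with u k have "p \<noteq> 0" by auto
  moreover have "poly_apply p A x = (\<Sum>k\<in>I. u (f k) *s f k)"
    by (simp add: p_def poly_apply_sum poly_apply_monom f_def)
  then have "poly_apply p A x = 0"
    using u(3) inj by (simp add: sum.reindex)
  ultimately show ?thesis by (rule that)
next
  case False
  then obtain i j where ij: "i \<noteq> j" "((*v) A ^^ i) x = ((*v) A ^^ j) x"
    by (auto simp: inj_on_def)
  define p :: "complex poly" where "p = monom 1 i + smult (-1) (monom 1 j)"
  have "coeff p i = 1" using ij by (simp add: p_def)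
  then have "p \<noteq> 0" by auto
  moreover have "poly_apply p A x = 0"
    unfolding p_def poly_apply_add_left poly_apply_smult poly_apply_monom using ij by simp
  ultimately show ?thesis by (rule that)
qed

section \<open>Spectral subspaces, their direct sums and their uniqueness\<close>

lemma gen_eigenspace_UNIV: "gen_eigenspace A UNIV = UNIV"
  using annihilating_poly gen_eigenspace_if_poly_apply_eq_0 by (metis UNIV_eq_I)

text \<open>For a common element \<open>x\<close>, the vector \<open>(A - z) x\<close> is again
  common, hence 0 by induction. A nonzero \<open>x\<close> would then be an eigenvector for some
  \<open>z\<close> in \<open>S\<close>, which must also lie in \<open>T\<close>.\<close>

lemma gen_eigenspace_disjoint:
  assumes "S \<inter> T = {}"
  shows "gen_eigenspace A S \<inter> gen_eigenspace A T = {0}"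
proof -
  have "x = 0" if "x \<in> gen_eigenspace A S" "x \<in> gen_eigenspace A T" for x
    using that
  proof (induction rule: gen_eigenspace.induct)
    case (step z x)
    then have "A *v x = z *s x"
      using gen_eigenspace_shift by fastforce
    with step assms show ?case
      using eigenvalue_gen_eigenspace by blast
  qed simp
  then show ?thesis by (auto simp: gen_eigenspace.zero)
qed

text \<open>Maximality of the spectral subspace, the source of all uniqueness claims. Every vector
  is annihilated by some product of factors; those with \<open>z\<close> outside \<open>S\<close>
  can be cancelled inside \<open>V\<close>.\<close>

lemma invariant_subspace_subset_gen_eigenspace:
  assumes V: "invariant_subspace A V" and S: "spectrum_on A V \<subseteq> S"
  shows "V \<subseteq> gen_eigenspace A S"
proof -
  have sub: "vec.subspace V" and mult: "\<And>x. x \<in> V \<Longrightarrow> A *v x \<in> V"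
    using V by (auto simp: invariant_subspace_def)
  define W where "W = V \<inter> gen_eigenspace A S"
  have W: "invariant_subspace A W"
    using V invariant_gen_eigenspace[of A S]
    by (auto simp: W_def invariant_subspace_def vec.subspace_inter)
  have "x \<in> gen_eigenspace A S" if "x \<in> gen_eigenspace A UNIV" "x \<in> V" for x
    using that
  proof (induction rule: gen_eigenspace.induct)
    case zero
    then show ?case by (simp add: gen_eigenspace.zero)
  next
    case (step z x)
    have AxV: "A *v x - z *s x \<in> V"
      using step.prems sub mult by (auto intro: vec.subspace_diff vec.subspace_scale)
    then have AxE: "A *v x - z *s x \<in> gen_eigenspace A S"
      using step.IH by blast
    show ?case
    proof (cases "z \<in> S")
      case True
      then show ?thesis using AxE by (rule gen_eigenspace.step)
    next
      case False
      \<comment> \<open>\<open>A - z\<close> is bijective on \<open>W\<close>, so some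
        \<open>e\<close> in \<open>W\<close> has the same image as \<open>x\<close>. Then
        \<open>x - e\<close> lies in \<open>V\<close> and is killed by \<open>A - z\<close>, which
        is injective on \<open>V\<close>, so \<open>x = e\<close>.\<close>
      have z: "z \<notin> spectrum_on A W"
        using False unfolding spectrum_on_eq_eigenvalues[OF W]
      by (auto simp: W_def dest: eigenvalue_gen_eigenspace)
      then have "bij_betw (\<lambda>x. A *v x - z *s x) W W"
        by (simp add: spectrum_on_def)
      moreover have "A *v x - z *s x \<in> W"
        using AxV AxE by (simp add: W_def)
      ultimately obtain e where e: "e \<in> W" "A *v e - z *s e = A *v x - z *s x"
        by (metis (no_types, lifting) bij_betw_imp_surj_on image_iff)
      then have eV: "x - e \<in> V"
        using step.prems sub by (auto simp: W_def intro: vec.subspace_diff)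
      moreover have "A *v (x - e) = z *s (x - e)"
        using e by (simp add: vec.diff vector_ssub_ldistrib algebra_simps)
      moreover have "z \<notin> spectrum_on A V"
        using False S by blast
      ultimately have "x = e"
        unfolding spectrum_on_eq_eigenvalues[OF V] by (metis (mono_tags, lifting) eq_iff_diff_eq_0 mem_Collect_eq)
      then show ?thesis using e by (simp add: W_def)
    qed
  qed
  then show ?thesis by (auto simp: gen_eigenspace_UNIV)
qed

text \<open>Lets a modulus threshold be moved freely inside a gap of the spectrum.\<close>

lemma gen_eigenspace_Int_spectrum: "gen_eigenspace A S = gen_eigenspace A (S \<inter> spectrum A)"
proof
  show "gen_eigenspace A S \<subseteq> gen_eigenspace A (S \<inter> spectrum A)"
    by (rule invariant_subspace_subset_gen_eigenspace[OF invariant_gen_eigenspace])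
      (auto simp: spectrum_on_gen_eigenspace)
qed (simp add: gen_eigenspace_mono)

lemma direct_sum_gen_eigenspace:
  assumes "S \<inter> T = {}"
  shows "direct_sum (gen_eigenspace A (S \<union> T)) (gen_eigenspace A S) (gen_eigenspace A T)"
proof -
  define W where "W = {u + v | u v. u \<in> gen_eigenspace A S \<and> v \<in> gen_eigenspace A T}"
  \<comment> \<open>A factor \<open>A - z\<close> with \<open>z\<close> outside \<open>T'\<close> is
    invertible on the \<open>T'\<close> part. Pulling \<open>v\<close> back to \<open>w\<close>
    leaves \<open>x - w\<close> in the \<open>S'\<close> part. The sets are kept generic because the
    roles of \<open>S\<close> and \<open>T\<close> are exchanged below.\<close>
  have one: "\<exists>u\<in>gen_eigenspace A S'. \<exists>v\<in>gen_eigenspace A T'. x = u + v"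
    if "z \<in> S'" "z \<notin> T'" and u: "u \<in> gen_eigenspace A S'" and v: "v \<in> gen_eigenspace A T'"
      and x: "A *v x - z *s x = u + v" for x z u v S' T'
  proof -
    have "z \<notin> spectrum_on A (gen_eigenspace A T')"
      using that by (simp add: spectrum_on_gen_eigenspace)
    then have "bij_betw (\<lambda>x. A *v x - z *s x) (gen_eigenspace A T') (gen_eigenspace A T')"
      by (simp add: spectrum_on_def)
    then obtain w where w: "w \<in> gen_eigenspace A T'" "v = A *v w - z *s w"
      using v by (metis (no_types, lifting) bij_betw_imp_surj_on image_iff)
    have "A *v (x - w) - z *s (x - w) = u"
      using x w by (simp add: vec.diff vector_ssub_ldistrib algebra_simps)
    then have "x - w \<in> gen_eigenspace A S'"
      using u that(1) gen_eigenspace.step by metis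
    with w show ?thesis by (metis diff_add_cancel)
  qed
  have "x \<in> W" if "x \<in> gen_eigenspace A (S \<union> T)" for x
    using that
  proof (induction rule: gen_eigenspace.induct)
    case zero
    then show ?case unfolding W_def using gen_eigenspace.zero by force
  next
    case (step z x)
    then obtain u v where uv: "u \<in> gen_eigenspace A S" "v \<in> gen_eigenspace A T"
      "A *v x - z *s x = u + v"
      by (auto simp: W_def)
    show ?case
    proof (cases "z \<in> S")
      case True
      then have "z \<notin> T" using assms by auto
      from one[OF True this uv] show ?thesis by (auto simp: W_def)
    next
      case False
      then have "z \<in> T" using step by auto
      moreover have "A *v x - z *s x = v + u"
        using uv(3) by (simp add: add.commute)
      ultimately obtain u v where
        "u \<in> gen_eigenspace A T" "v \<in> gen_eigenspace A S" "x = v + u"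
        using one[OF _ False uv(2,1)] by (metis add.commute)
      then show ?thesis by (auto simp: W_def)
    qed
  qed
  moreover have "W \<subseteq> gen_eigenspace A (S \<union> T)"
    using gen_eigenspace_mono[of S "S \<union> T" A] gen_eigenspace_mono[of T "S \<union> T" A]
    by (auto simp: W_def intro!: gen_eigenspace_add)
  ultimately show ?thesis
    using gen_eigenspace_disjoint[OF assms, of A] by (auto simp: direct_sum_def W_def)
qed

text \<open>Maximality puts \<open>U\<close> and \<open>V\<close> inside the two spectral subspaces.
  As these meet only in 0, the component of an element of one of them in the wrong summand
  vanishes.\<close>

lemma spectral_split_unique:
  assumes "S \<inter> T = {}"
    and U: "invariant_subspace A U" and V: "invariant_subspace A V"
    and sum: "direct_sum (gen_eigenspace A (S \<union> T)) U V"
    and sU: "spectrum_on A U \<subseteq> S" and sV: "spectrum_on A V \<subseteq> T"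
  shows "U = gen_eigenspace A S \<and> V = gen_eigenspace A T"
proof -
  have UE: "U \<subseteq> gen_eigenspace A S" and VE: "V \<subseteq> gen_eigenspace A T"
    using invariant_subspace_subset_gen_eigenspace U V sU sV by blast+
  have subs: "vec.subspace (gen_eigenspace A S)" "vec.subspace (gen_eigenspace A T)"
    using subspace_gen_eigenspace by auto
  have dis: "gen_eigenspace A S \<inter> gen_eigenspace A T = {0}"
    by (rule gen_eigenspace_disjoint[OF assms(1)])
  have decomp: "\<exists>u\<in>U. \<exists>v\<in>V. x = u + v" if "x \<in> gen_eigenspace A (S \<union> T)" for x
    using sum that by (auto simp: direct_sum_def)
  have "x \<in> U" if x: "x \<in> gen_eigenspace A S" for x
  proof -
    obtain u v where uv: "u \<in> U" "v \<in> V" "x = u + v"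
      using decomp x gen_eigenspace_mono[of S "S \<union> T" A] by blast
    then have "v = x - u" by simp
    then have "v \<in> gen_eigenspace A S"
      using x uv UE vec.subspace_diff[OF subs(1)] by blast
    then have "v = 0" using dis uv VE by blast
    with uv show ?thesis by simp
  qed
  moreover have "x \<in> V" if x: "x \<in> gen_eigenspace A T" for x
  proof -
    obtain u v where uv: "u \<in> U" "v \<in> V" "x = u + v"
      using decomp x gen_eigenspace_mono[of T "S \<union> T" A] by blast
    then have "u = x - v" by simp
    then have "u \<in> gen_eigenspace A T"
      using x uv VE vec.subspace_diff[OF subs(2)] by blast
    then have "u = 0" using dis uv UE by blast
    with uv show ?thesis by simp
  qed
  ultimately show ?thesis using UE VE by blast
qed

lemma dim_direct_sum:
  assumes "direct_sum W U V" "vec.subspace U" "vec.subspace V"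
  shows "vec.dim W = vec.dim U + vec.dim V"
  using vec.dim_sums_Int[OF assms(2,3)] assms(1) by (simp add: direct_sum_def)

section \<open>Growth of matrix powers and forms expanded by a matrix\<close>

lemma tendsto_0_if_perturbed_contraction:
  fixes y e :: "nat \<Rightarrow> 'a::real_normed_vector"
  assumes step: "\<And>k. norm (y (Suc k)) \<le> q * norm (y k) + norm (e k)"
    and q: "0 \<le> q" "q < 1" and e: "e \<longlonglongrightarrow> 0"
  shows "y \<longlonglongrightarrow> 0"
proof (rule LIMSEQ_I)
  fix r :: real assume "0 < r"
  \<comment> \<open>Chosen such that \<open>r / 2\<close> is the fixed point of
    \<open>t \<mapsto> q * t + d\<close>; the bound below then survives every step.\<close>
  define d where "d = r * (1 - q) / 2"
  have "d > 0" using \<open>0 < r\<close> q by (simp add: d_def)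
  then obtain K where K: "\<And>k. k \<ge> K \<Longrightarrow> norm (e k) < d"
    using LIMSEQ_D[OF e] by force
  have bound: "norm (y (K + k)) \<le> q ^ k * norm (y K) + r / 2" for k
  proof (induction k)
    case 0
    then show ?case using \<open>0 < r\<close> by simp
  next
    case (Suc k)
    have "norm (y (K + Suc k)) \<le> q * norm (y (K + k)) + d"
      using step[of "K + k"] K[of "K + k"] by simp
    also have "\<dots> \<le> q * (q ^ k * norm (y K) + r / 2) + d"
      using Suc q by (simp add: mult_left_mono)
    also have "\<dots> = q ^ Suc k * norm (y K) + r / 2"
      by (simp add: d_def field_simps)
    finally show ?case .
  qed
  have "(\<lambda>k. q ^ k * norm (y K)) \<longlonglongrightarrow> 0 * norm (y K)"
    by (intro tendsto_intros LIMSEQ_realpow_zero q)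
  then obtain M where M: "\<And>k. k \<ge> M \<Longrightarrow> \<bar>q ^ k * norm (y K)\<bar> < r / 2"
    using LIMSEQ_D[of "\<lambda>k. q ^ k * norm (y K)" 0 "r / 2"] \<open>0 < r\<close> by auto
  have "norm (y n - 0) < r" if "n \<ge> K + M" for n
  proof -
    have "q ^ (n - K) * norm (y K) < r / 2"
      using M[of "n - K"] that by linarith
    with bound[of "n - K"] that show ?thesis by simp
  qed
  then show "\<exists>no. \<forall>n\<ge>no. norm (y n - 0) < r" by blast
qed

lemma norm_scalar_mult_vec: "norm (c *s x) = cmod c * norm (x :: complex^'n)"
proof -
  have "norm (c *s x) = L2_set (\<lambda>i. cmod c * norm (x $ i)) UNIV"
    by (simp add: norm_vec_def norm_mult)
  then show ?thesis
    by (simp add: L2_set_right_distrib norm_vec_def)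
qed

text \<open>With \<open>y k = A^k x / c^k\<close>, peeling off one factor gives
  \<open>y (k+1) = (z/c) y k + e k / c\<close>, where \<open>e k\<close> tends to 0 by induction and
  \<open>cmod z / c < 1\<close>.\<close>

lemma scaled_powers_tendsto_0:
  assumes "x \<in> gen_eigenspace A {z. cmod z < c}" "c > 0"
  shows "(\<lambda>k. ((*v) A ^^ k) x /\<^sub>R c ^ k) \<longlonglongrightarrow> 0"
  using assms(1)
proof (induction rule: gen_eigenspace.induct)
  case zero
  have "((*v) A ^^ k) 0 = 0" for k by (induction k) auto
  then show ?case by simp
next
  case (step z x)
  let ?y = "\<lambda>k. ((*v) A ^^ k) x /\<^sub>R c ^ k"
  let ?e = "\<lambda>k. ((*v) A ^^ k) (A *v x - z *s x) /\<^sub>R c ^ k"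
  have pow_diff: "((*v) A ^^ k) (u - v) = ((*v) A ^^ k) u - ((*v) A ^^ k) v" for k u v
    by (induction k) (simp_all add: vec.diff)
  have pow_scale: "((*v) A ^^ k) (z *s u) = z *s ((*v) A ^^ k) u" for k u
    by (induction k) (simp_all add: vec.scale)
  have eq: "((*v) A ^^ Suc k) x = ((*v) A ^^ k) (A *v x - z *s x) + z *s ((*v) A ^^ k) x" for k
    by (simp add: pow_diff pow_scale funpow_swap1)
  have "norm (?y (Suc k)) \<le> cmod z / c * norm (?y k) + norm (?e k /\<^sub>R c)" for k
  proof -
    have "norm (((*v) A ^^ Suc k) x) \<le>
        norm (((*v) A ^^ k) (A *v x - z *s x)) + cmod z * norm (((*v) A ^^ k) x)"
      unfolding eq by (metis norm_triangle_ineq norm_scalar_mult_vec)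
    then show ?thesis
      using \<open>c > 0\<close> by (simp add: divide_simps)
  qed
  moreover have "cmod z / c < 1" using step \<open>c > 0\<close> by simp
  moreover have "(\<lambda>k. ?e k /\<^sub>R c) \<longlonglongrightarrow> 0"
    using tendsto_scaleR[OF tendsto_const step.IH] by simp
  ultimately show ?case
    using \<open>c > 0\<close> by (intro tendsto_0_if_perturbed_contraction[of ?y "cmod z / c" "\<lambda>k. ?e k /\<^sub>R c"]) auto
qed

text \<open>Along \<open>A^k x / c^k\<close> the form \<open>F\<close> does not decrease, its first
  increase is strict, and its limit is \<open>F 0 = 0\<close>. So \<open>F\<close> starts below
  0.\<close>

lemma expanding_form_negative:
  fixes F :: "complex^'n \<Rightarrow> real"
  assumes x: "x \<in> gen_eigenspace A {z. cmod z < c}" "x \<noteq> 0" and c: "c > 0"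
    and cont: "isCont F 0" and hom: "\<And>t x. F (t *\<^sub>R x) = t\<^sup>2 * F x"
    and exp: "\<And>x. x \<noteq> 0 \<Longrightarrow> c\<^sup>2 * F x < F (A *v x)"
  shows "F x < 0"
proof -
  define y where "y k = ((*v) A ^^ k) x /\<^sub>R c ^ k" for k
  have F0: "F 0 = 0" using hom[of 0 0] by simp
  have le: "c\<^sup>2 * F v \<le> F (A *v v)" for v
    using exp[of v] F0 by (cases "v = 0") auto
  have Fy: "F (y k) = F (((*v) A ^^ k) x) / (c\<^sup>2) ^ k" for k
    by (simp add: y_def hom field_simps flip: power_mult)
  have "c\<^sup>2 ^ k > 0" for k using c by simp
  then have mono: "F (y k) \<le> F (y (Suc k))" for k
    using le[of "((*v) A ^^ k) x"] c unfolding Fy by (simp add: field_simps)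
  have "(\<lambda>k. F (y k)) \<longlonglongrightarrow> F 0"
    using isCont_tendsto_compose[OF cont] scaled_powers_tendsto_0[OF x(1) c]
    by (simp add: y_def)
  then have "F (y 1) \<le> 0"
    using incseq_le[of "\<lambda>k. F (y k)"] mono F0 by (metis incseq_SucI)
  moreover have "F x < F (y 1)"
    using exp[OF x(2)] c by (simp add: Fy field_simps)
  ultimately show ?thesis by simp
qed

section \<open>Self-adjoint operators and square roots\<close>

text \<open>A maximiser \<open>v\<close> of \<open>x \<bullet> f x\<close> on the unit sphere of
  \<open>V\<close> is an eigenvector: the residual \<open>w = f v - \<mu> v\<close> must vanish,
  since moving from \<open>v\<close> along \<open>w\<close> would otherwise exceed the
  maximum.\<close>

lemma selfadjoint_eigenvector:
  fixes f :: "'a::euclidean_space \<Rightarrow> 'a"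
  assumes lin: "linear f" and sa: "\<And>x y. f x \<bullet> y = x \<bullet> f y"
    and V: "subspace V" "V \<noteq> {0}" "f ` V \<subseteq> V"
  obtains v \<mu> where "v \<in> V" "norm v = 1" "f v = \<mu> *\<^sub>R v"
proof -
  interpret linear f by (rule lin)
  let ?K = "V \<inter> sphere 0 1"
  have unit: "y /\<^sub>R norm y \<in> ?K" if "y \<in> V" "y \<noteq> 0" for y
    using that V(1) by (simp add: subspace_scale)
  have "compact ?K"
    by (simp add: V(1) closed_Int_compact closed_subspace)
  moreover have "?K \<noteq> {}"
    using unit V(1,2) subspace_0 by blast
  moreover have "continuous_on ?K (\<lambda>x. x \<bullet> f x)"
    by (intro continuous_intros linear_continuous_on linear_conv_bounded_linear[THEN iffD1] lin)
  ultimately obtain v where v: "v \<in> ?K" and max: "\<And>y. y \<in> ?K \<Longrightarrow> y \<bullet> f y \<le> v \<bullet> f v"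
    by (metis continuous_attains_sup)
  define \<mu> where "\<mu> = v \<bullet> f v"
  have vV: "v \<in> V" "v \<bullet> v = 1"
    using v by (auto simp: dot_square_norm)
  have le: "y \<bullet> f y \<le> \<mu> * (y \<bullet> y)" if "y \<in> V" for y
  proof (cases "y = 0")
    case False
    have "(y \<bullet> f y) / (norm y)\<^sup>2 \<le> \<mu>"
      using max[OF unit[OF that False]] by (simp add: scale \<mu>_def power2_eq_square field_simps)
    then show ?thesis
      using False by (simp add: pos_divide_le_eq dot_square_norm)
  qed simp
  define w where "w = f v - \<mu> *\<^sub>R v"
  have wV: "w \<in> V"
    unfolding w_def using V vV by (auto intro: subspace_diff subspace_scale)
  \<comment> \<open>The second-order coefficient of the variation along \<open>w\<close>. Inserting
    \<open>v + t w\<close> into \<open>le\<close> bounds the first-order gain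
    \<open>2 t (w \<bullet> w)\<close> by \<open>t^2 C\<close>, which fails for small positive
    \<open>t\<close> unless \<open>w = 0\<close>.\<close>
  define C where "C = \<mu> * (w \<bullet> w) - w \<bullet> f w"
  have quad: "2 * t * (w \<bullet> w) \<le> t\<^sup>2 * C" for t
  proof -
    have "v + t *\<^sub>R w \<in> V"
      using V(1) vV wV by (auto intro: subspace_add subspace_scale)
    from le[OF this] have
      "\<mu> + t * (v \<bullet> f w) + t * (w \<bullet> f v) + t\<^sup>2 * (w \<bullet> f w) \<le>
        \<mu> * (1 + t * (v \<bullet> w) + t * (w \<bullet> v) + t\<^sup>2 * (w \<bullet> w))"
      using vV(2)
      by (simp add: add scale inner_add_left inner_add_right \<mu>_def power2_eq_square algebra_simps)
    moreover have "v \<bullet> f w = w \<bullet> f v"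
      by (metis sa inner_commute)
    moreover have "w \<bullet> f v = w \<bullet> w + \<mu> * (w \<bullet> v)"
      by (simp add: w_def inner_diff_right algebra_simps)
    ultimately show ?thesis
      by (simp add: C_def inner_commute algebra_simps)
  qed
  have "w \<bullet> w = 0"
  proof (rule ccontr)
    assume "w \<bullet> w \<noteq> 0"
    then have a: "w \<bullet> w > 0" by simp
    define t where "t = (w \<bullet> w) / (\<bar>C\<bar> + 1)"
    have t: "t > 0" using a by (simp add: t_def)
    have "2 * (w \<bullet> w) \<le> t * C"
      using quad[of t] t by (simp add: power2_eq_square)
    also have "\<dots> \<le> t * (\<bar>C\<bar> + 1)"
      using t by (intro mult_left_mono) auto
    also have "\<dots> = w \<bullet> w"
      by (simp add: t_def)
    finally show False using a by simp
  qed
  then have "f v = \<mu> *\<^sub>R v" by (simp add: w_def)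
  with v show ?thesis by (auto intro: that)
qed

text \<open>Induction on the dimension: self-adjointness makes the orthogonal complement in
  \<open>V\<close> of a unit eigenvector invariant.\<close>

lemma selfadjoint_eigenbasis_subspace:
  fixes f :: "'a::euclidean_space \<Rightarrow> 'a"
  assumes lin: "linear f" and sa: "\<And>x y. f x \<bullet> y = x \<bullet> f y"
    and V: "subspace V" "f ` V \<subseteq> V"
  shows "\<exists>B. finite B \<and> B \<subseteq> V \<and> pairwise orthogonal B \<and>
    (\<forall>b\<in>B. norm b = 1 \<and> (\<exists>\<mu>. f b = \<mu> *\<^sub>R b)) \<and> V \<subseteq> span B"
  using V
proof (induction "dim V" arbitrary: V rule: less_induct)
  case less
  show ?case
  proof (cases "V = {0}")
    case True
    then show ?thesis by (intro exI[of _ "{}"]) auto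
  next
    case False
    obtain v \<mu> where v: "v \<in> V" "norm v = 1" "f v = \<mu> *\<^sub>R v"
      by (rule selfadjoint_eigenvector[OF lin sa less.prems(1) False less.prems(2)])
    define W where "W = V \<inter> {x. v \<bullet> x = 0}"
    have W: "subspace W"
      by (simp add: W_def less.prems subspace_inter subspace_hyperplane)
    have "f ` W \<subseteq> W"
      using less.prems(2) v(3) by (auto simp: W_def simp flip: sa)
    moreover have "dim W < dim V"
    proof (rule dim_psubset)
      have "v \<notin> W" using v by (auto simp: W_def)
      then have "W \<subset> V" using v(1) unfolding W_def by blast
      then show "span W \<subset> span V"
        using W less.prems(1) by (simp add: span_eq_iff[THEN iffD2])
    qed
    ultimately obtain B where B: "finite B" "B \<subseteq> W" "pairwise orthogonal B" "W \<subseteq> span B"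
      "\<forall>b\<in>B. norm b = 1 \<and> (\<exists>\<mu>. f b = \<mu> *\<^sub>R b)"
      using less.hyps[OF _ W] by blast
    have "x \<in> span (insert v B)" if "x \<in> V" for x
    proof -
      have "x - (v \<bullet> x) *\<^sub>R v \<in> W"
        using that v less.prems(1)
        by (auto simp: W_def inner_diff_right dot_square_norm intro: subspace_diff subspace_scale)
      then have "x - (v \<bullet> x) *\<^sub>R v \<in> span B" using B by blast
      then show ?thesis by (auto simp: span_insert)
    qed
    moreover have "pairwise orthogonal (insert v B)"
      using B(2,3) by (auto simp: pairwise_insert W_def orthogonal_def inner_commute)
    ultimately show ?thesis
      using B v by (intro exI[of _ "insert v B"]) (auto simp: W_def)
  qed
qed

text \<open>Formulated for real inner product spaces, so that it serves real matrices and also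
  complex ones. For the latter, \<open>inner\<close> is the real part of the Hermitian product and
  \<open>B\<close> is an orthonormal basis over the reals.\<close>

locale selfadjoint_eigenbasis =
  fixes f :: "'a::euclidean_space \<Rightarrow> 'a" and B :: "'a set" and \<mu> :: "'a \<Rightarrow> real"
  assumes linear: "linear f" and selfadjoint: "\<And>x y. f x \<bullet> y = x \<bullet> f y"
    and finite_basis: "finite B" and orthogonal_basis: "pairwise orthogonal B"
    and norm_basis: "\<And>b. b \<in> B \<Longrightarrow> norm b = 1"
    and span_basis: "span B = UNIV"
    and eigen: "\<And>b. b \<in> B \<Longrightarrow> f b = \<mu> b *\<^sub>R b"
begin

lemma expansion: "(\<Sum>b\<in>B. (b \<bullet> x) *\<^sub>R b) = x"
proof -
  have "(\<Sum>b\<in>B. (x \<bullet> b) *\<^sub>R b) = x"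
    using orthonormal_basis_expand[OF orthogonal_basis norm_basis _ finite_basis] span_basis
    by simp
  then show ?thesis by (simp add: inner_commute)
qed

lemma inner_expansion: "x \<bullet> y = (\<Sum>b\<in>B. (b \<bullet> x) * (b \<bullet> y))"
proof -
  have "x \<bullet> y = (\<Sum>b\<in>B. (b \<bullet> x) *\<^sub>R b) \<bullet> y" by (simp only: expansion)
  then show ?thesis by (simp add: inner_sum_left)
qed

lemma norm_expansion: "(norm x)\<^sup>2 = (\<Sum>b\<in>B. (b \<bullet> x)\<^sup>2)"
  unfolding power2_norm_eq_inner inner_expansion[of x x] by (simp add: power2_eq_square)

lemma inner_image: "b \<in> B \<Longrightarrow> b \<bullet> f x = \<mu> b * (b \<bullet> x)"
  by (simp add: eigen flip: selfadjoint)

lemma eq_iff_coordinates: "x = y \<longleftrightarrow> (\<forall>b\<in>B. b \<bullet> x = b \<bullet> y)"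
proof
  assume "\<forall>b\<in>B. b \<bullet> x = b \<bullet> y"
  then have "(\<Sum>b\<in>B. (b \<bullet> x) *\<^sub>R b) = (\<Sum>b\<in>B. (b \<bullet> y) *\<^sub>R b)"
    by (intro sum.cong) auto
  then show "x = y" by (simp only: expansion)
qed simp

lemma norm_image: "(norm (f x))\<^sup>2 = (\<Sum>b\<in>B. (\<mu> b)\<^sup>2 * (b \<bullet> x)\<^sup>2)"
  by (simp add: norm_expansion inner_image power_mult_distrib)

lemma eigenvalue_in_image:
  assumes "f x = c *\<^sub>R x" "x \<noteq> 0"
  shows "c \<in> \<mu> ` B"
proof -
  obtain b where b: "b \<in> B" "b \<bullet> x \<noteq> 0"
    using assms(2) eq_iff_coordinates[of x 0] by auto
  then have "\<mu> b * (b \<bullet> x) = c * (b \<bullet> x)"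
    using assms(1) inner_image by (metis inner_scaleR_right)
  with b show ?thesis by auto
qed

lemma basis_nonempty: "(x :: 'a) \<noteq> 0 \<Longrightarrow> B \<noteq> {}"
  using eq_iff_coordinates[of x 0] by auto

end

lemma selfadjoint_eigenbasis_exists:
  fixes f :: "'a::euclidean_space \<Rightarrow> 'a"
  assumes "linear f" "\<And>x y. f x \<bullet> y = x \<bullet> f y"
  obtains B \<mu> where "selfadjoint_eigenbasis f B \<mu>"
proof -
  obtain B where B: "finite B" "pairwise orthogonal B" "UNIV \<subseteq> span B"
    "\<forall>b\<in>B. norm b = 1 \<and> (\<exists>\<mu>. f b = \<mu> *\<^sub>R b)"
    using selfadjoint_eigenbasis_subspace[OF assms, of UNIV] by auto
  then obtain \<mu> where "\<forall>b\<in>B. f b = \<mu> b *\<^sub>R b" by metis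
  with B assms have "selfadjoint_eigenbasis f B \<mu>" by (intro selfadjoint_eigenbasis.intro) auto
  then show ?thesis by (rule that)
qed

section \<open>Positive semidefinite square roots\<close>

lemma symmetric_selfadjoint:
  fixes M :: "real^'n^'n"
  assumes "transpose M = M"
  shows "(M *v x) \<bullet> y = x \<bullet> (M *v y)"
  by (metis assms dot_lmul_matrix inner_commute transpose_matrix_vector)

text \<open>The vector \<open>y = S x - sqrt c x\<close> satisfies \<open>S y = - sqrt c y\<close>,
  which positivity of \<open>S\<close> forbids for \<open>c > 0\<close> unless \<open>y = 0\<close>.
  For \<open>c = 0\<close> one has \<open>|S x|^2 = x \<bullet> S (S x) = 0\<close>.\<close>

lemma pos_semidef_root_eigenvector:
  fixes S M :: "real^'n^'n"
  assumes S: "pos_semidef S" "S ** S = M" and x: "M *v x = c *\<^sub>R x" and "c \<ge> 0"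
  shows "S *v x = sqrt c *\<^sub>R x"
proof -
  have SS: "S *v (S *v x) = c *\<^sub>R x"
    using S x by (simp add: matrix_vector_mul_assoc)
  have sa: "(S *v u) \<bullet> w = u \<bullet> (S *v w)" for u w
    using S(1) by (simp add: pos_semidef_def symmetric_selfadjoint)
  define y where "y = S *v x - sqrt c *\<^sub>R x"
  have "S *v y = - sqrt c *\<^sub>R y"
    using \<open>c \<ge> 0\<close>
    by (simp add: y_def SS matrix_vector_mult_diff_distrib matrix_vector_mult_scaleR algebra_simps)
  moreover have "0 \<le> y \<bullet> (S *v y)"
    using S(1) by (simp add: pos_semidef_def)
  ultimately have le: "sqrt c * (y \<bullet> y) \<le> 0" by simp
  have "y = 0"
  proof (cases "c = 0")
    case True
    then have "y \<bullet> y = 0" using SS by (simp add: y_def sa)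
    then show ?thesis by simp
  next
    case False
    then have "sqrt c > 0" using \<open>c \<ge> 0\<close> by simp
    with le have "y \<bullet> y \<le> 0" by (simp add: mult_le_0_iff)
    then show ?thesis by (metis inner_gt_zero_iff not_less)
  qed
  then show ?thesis by (simp add: y_def)
qed

text \<open>Gives meaning to the definite description in \<open>psd_sqrt\<close>. Existence takes
  roots of the eigenvalues in an eigenbasis; uniqueness holds because every root is determined on
  that basis by the preceding lemma.\<close>

lemma ex1_psd_sqrt:
  fixes M :: "real^'n^'n"
  assumes M: "pos_semidef M"
  shows "\<exists>!S. pos_semidef S \<and> S ** S = M"
proof -
  have sa: "(M *v x) \<bullet> y = x \<bullet> (M *v y)" for x y
    using M by (simp add: pos_semidef_def symmetric_selfadjoint)
  obtain B \<mu> where "selfadjoint_eigenbasis ((*v) M) B \<mu>"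
    by (rule selfadjoint_eigenbasis_exists[of "(*v) M"]) (use sa in auto)
  then interpret M: selfadjoint_eigenbasis "(*v) M" B \<mu> .
  have nonneg: "\<mu> b \<ge> 0" if "b \<in> B" for b
  proof -
    have "0 \<le> b \<bullet> (M *v b)" using M by (simp add: pos_semidef_def)
    then show ?thesis using that by (simp add: M.eigen dot_square_norm M.norm_basis)
  qed
  define g where "g x = (\<Sum>b\<in>B. (sqrt (\<mu> b) * (b \<bullet> x)) *\<^sub>R b)" for x
  have lin: "linear g"
    unfolding g_def
    by (rule linearI) (simp_all add: inner_add_right algebra_simps sum.distrib scaleR_sum_right)
  define S where "S = matrix g"
  have S: "S *v x = g x" for x
    by (simp add: S_def lin matrix_works)
  have inner_S: "(S *v x) \<bullet> y = (\<Sum>b\<in>B. sqrt (\<mu> b) * (b \<bullet> x) * (b \<bullet> y))" for x y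
    by (simp add: S g_def inner_sum_left)
  have S_basis: "b \<bullet> (S *v x) = sqrt (\<mu> b) * (b \<bullet> x)" if "b \<in> B" for b x
  proof -
    have "c \<bullet> b = (if c = b then 1 else 0)" if "c \<in> B" for c
      using M.orthogonal_basis M.norm_basis that \<open>b \<in> B\<close>
      by (auto simp: pairwise_def orthogonal_def dot_square_norm)
    then have "(S *v x) \<bullet> b = (\<Sum>c\<in>B. if c = b then sqrt (\<mu> b) * (b \<bullet> x) else 0)"
      unfolding inner_S by (intro sum.cong) auto
    also have "\<dots> = sqrt (\<mu> b) * (b \<bullet> x)"
      using that M.finite_basis by simp
    finally show ?thesis by (simp add: inner_commute)
  qed
  have "x \<bullet> (transpose S *v y) = x \<bullet> (S *v y)" for x y
  proof -
    have "x \<bullet> (transpose S *v y) = (S *v x) \<bullet> y"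
      by (metis dot_lmul_matrix inner_commute transpose_matrix_vector)
    also have "\<dots> = (S *v y) \<bullet> x"
      unfolding inner_S by (simp add: mult.commute mult.left_commute)
    finally show ?thesis by (simp add: inner_commute)
  qed
  then have "transpose S *v y = S *v y" for y
    by (metis vector_eq_rdot inner_commute)
  then have "transpose S = S" by (simp add: matrix_eq)
  moreover have "0 \<le> x \<bullet> (S *v x)" for x
    unfolding inner_commute[of x] inner_S
    by (intro sum_nonneg) (simp add: nonneg mult.assoc)
  moreover have "S *v (S *v x) = M *v x" for x
    unfolding M.eq_iff_coordinates[of "S *v (S *v x)"]
    by (simp add: S_basis M.inner_image nonneg flip: mult.assoc)
  then have "S ** S = M"
    by (simp add: matrix_eq flip: matrix_vector_mul_assoc)
  ultimately have S_root: "pos_semidef S \<and> S ** S = M"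
    by (simp add: pos_semidef_def)
  have "T = S" if T: "pos_semidef T \<and> T ** T = M" for T
  proof -
    have "T *v b = S *v b" if "b \<in> B" for b
      using that T S_root M.eigen nonneg pos_semidef_root_eigenvector by metis
    then have "T *v x = S *v x" for x
      using M.span_basis linear_eq_on_span[of "(*v) T" "(*v) S" B] by auto
    then show ?thesis by (simp add: matrix_eq)
  qed
  with S_root show ?thesis by blast
qed

lemma
  assumes "pos_semidef M"
  shows pos_semidef_psd_sqrt: "pos_semidef (psd_sqrt M)"
    and psd_sqrt_mult_self: "psd_sqrt M ** psd_sqrt M = M"
  using theI'[OF ex1_psd_sqrt[OF assms]] by (auto simp: psd_sqrt_def)

lemma pos_def_imp_pos_semidef: "pos_def M \<Longrightarrow> pos_semidef M"
  by (auto simp: pos_def_def pos_semidef_def) (metis inner_zero_left order.refl less_imp_le)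

lemma
  fixes M :: "real^'n^'n"
  assumes "pos_def M"
  shows psd_sqrt_inv_left: "matrix_inv (psd_sqrt M) ** psd_sqrt M = mat 1"
    and psd_sqrt_inv_right: "psd_sqrt M ** matrix_inv (psd_sqrt M) = mat 1"
    and transpose_psd_sqrt: "transpose (psd_sqrt M) = psd_sqrt M"
    and transpose_inv_psd_sqrt: "transpose (matrix_inv (psd_sqrt M)) = matrix_inv (psd_sqrt M)"
proof -
  let ?S = "psd_sqrt M"
  have SS: "?S ** ?S = M"
    by (rule psd_sqrt_mult_self[OF pos_def_imp_pos_semidef[OF assms]])
  have "x = 0" if "?S *v x = 0" for x
  proof -
    have "M *v x = ?S *v (?S *v x)"
      by (simp add: SS matrix_vector_mul_assoc)
    then have "x \<bullet> (M *v x) = 0" using that by simp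
    then show ?thesis using assms by (auto simp: pos_def_def)
  qed
  then have "invertible ?S"
    by (metis invertible_left_inverse matrix_left_invertible_ker)
  then have "\<exists>A. ?S ** A = mat 1 \<and> A ** ?S = mat 1"
    by (simp add: invertible_def)
  then show left: "matrix_inv ?S ** ?S = mat 1" and right: "?S ** matrix_inv ?S = mat 1"
    unfolding matrix_inv_def by (metis (mono_tags, lifting) someI_ex)+
  show t: "transpose ?S = ?S"
    using pos_semidef_psd_sqrt[OF pos_def_imp_pos_semidef[OF assms]] by (simp add: pos_semidef_def)
  have "?S ** transpose (matrix_inv ?S) = mat 1"
    using arg_cong[OF left, of transpose] by (simp add: matrix_transpose_mul t transpose_mat)
  then show "transpose (matrix_inv ?S) = matrix_inv ?S"
    by (metis left matrix_mul_assoc matrix_mul_lid matrix_mul_rid)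
qed

section \<open>Complexification and block matrices\<close>

lemma inner_scalar_mult_complex: "(z *s x) \<bullet> (w *s x) = Re (cnj z * w) * (x \<bullet> (x :: complex^'n))"
proof -
  have "(z * a) \<bullet> (w * a) = Re (cnj z * w) * (a \<bullet> a)" for a :: complex
    by (simp add: inner_complex_def algebra_simps)
  then show ?thesis by (simp add: inner_vec_def sum_distrib_left)
qed

lemma inner_ii_mult: "(\<i> *s x) \<bullet> y = - (x \<bullet> (\<i> *s (y :: complex^'n)))"
proof -
  have "(\<i> * a) \<bullet> b = - (a \<bullet> (\<i> * b))" for a b :: complex
    by (simp add: inner_complex_def algebra_simps)
  then show ?thesis by (simp add: inner_vec_def sum_negf)
qed

lemma scaleR_eq_scalar_mult: "r *\<^sub>R x = complex_of_real r *s (x :: complex^'n)"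
  unfolding vec_eq_iff vector_scaleR_component vector_smult_component
  by (simp add: scaleR_conv_of_real)

lemma linear_complex_matrix: "linear ((*v) (M :: complex^'n^'m))"
  by (rule linearI) (simp_all add: vec.add vec.scale scaleR_eq_scalar_mult)

lemma hermitian_selfadjoint:
  fixes M :: "complex^'n^'n"
  assumes "\<And>i j. M $ i $ j = cnj (M $ j $ i)"
  shows "(M *v x) \<bullet> y = x \<bullet> (M *v y)"
proof -
  have mult: "(a * b) \<bullet> c = b \<bullet> (cnj a * c)" for a b c :: complex
    by (simp add: inner_complex_def algebra_simps)
  have "(M *v x) \<bullet> y = (\<Sum>i\<in>UNIV. \<Sum>j\<in>UNIV. x $ j \<bullet> (cnj (M $ i $ j) * y $ i))"
    by (simp add: inner_vec_def matrix_vector_mult_def inner_sum_left mult)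
  also have "\<dots> = (\<Sum>j\<in>UNIV. \<Sum>i\<in>UNIV. x $ j \<bullet> (M $ j $ i * y $ i))"
    by (subst sum.swap) (simp flip: assms)
  also have "\<dots> = x \<bullet> (M *v y)"
    by (simp add: inner_vec_def matrix_vector_mult_def inner_sum_right)
  finally show ?thesis .
qed

text \<open>For the real inner product, self-adjointness is tested on the pair \<open>v\<close>,
  \<open>\<i> *s v\<close>: its two sides are \<open>Im z\<close> and \<open>- Im z\<close> times
  \<open>v \<bullet> v\<close>.\<close>

lemma selfadjoint_eigenvalue_real:
  fixes M :: "complex^'n^'n"
  assumes sa: "\<And>x y. (M *v x) \<bullet> y = x \<bullet> (M *v y)" and v: "M *v v = z *s v" "v \<noteq> 0"
  shows "Im z = 0"
proof -
  have "(M *v v) \<bullet> (\<i> *s v) = Im z * (v \<bullet> v)"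
    by (simp add: v inner_scalar_mult_complex)
  moreover have "v \<bullet> (M *v (\<i> *s v)) = - Im z * (v \<bullet> v)"
    using inner_scalar_mult_complex[of 1 v "\<i> * z"] by (simp add: vec.scale v vector_smult_assoc)
  ultimately have "2 * Im z * (v \<bullet> v) = 0"
    using sa[of v "\<i> *s v"] by simp
  then show ?thesis using v(2) by simp
qed

lemma spectrum_selfadjoint:
  assumes "selfadjoint_eigenbasis ((*v) M) B \<mu>"
  shows "spectrum M = complex_of_real ` \<mu> ` B"
proof -
  interpret selfadjoint_eigenbasis "(*v) M" B \<mu> by (rule assms)
  have "z \<in> complex_of_real ` \<mu> ` B" if "M *v v = z *s v" "v \<noteq> 0" for z v
  proof -
    have "z = of_real (Re z)"
      using selfadjoint_eigenvalue_real[OF selfadjoint that] by (simp add: complex_eq_iff)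
    moreover from this have "M *v v = Re z *\<^sub>R v"
      using that(1) by (simp add: scaleR_eq_scalar_mult)
    then have "Re z \<in> \<mu> ` B"
      using that(2) by (rule eigenvalue_in_image)
    ultimately show ?thesis by blast
  qed
  moreover have "complex_of_real (\<mu> b) \<in> spectrum M" if "b \<in> B" for b
    using eigen[OF that] norm_basis[OF that]
    by (auto simp: spectrum_eq scaleR_eq_scalar_mult intro!: exI[of _ b])
  ultimately show ?thesis by (auto simp: spectrum_eq)
qed

lemma cmat_mult: "cmat (M ** N) = cmat M ** cmat N"
  by (simp add: vec_eq_iff matrix_matrix_mult_def)

lemma cmat_mat_1: "cmat (mat 1) = mat 1"
  by (simp add: vec_eq_iff mat_def)

lemma cmat_mult_vec: "cmat M *v (cmat N *v x) = cmat (M ** N) *v x"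
  by (simp add: cmat_mult matrix_vector_mul_assoc)

lemma map_matrix_mult_vec: "map_matrix ((*) c) M *v x = c *s (M *v x)"
  by (simp add: vec_eq_iff matrix_vector_mult_def sum_distrib_left mult.assoc)

section \<open>Block vectors, exchange of blocks, and rank under complexification\<close>

definition join :: "'a^'n \<Rightarrow> 'a^'m \<Rightarrow> 'a^('n + 'm)" where
  "join u v = (\<chi> i. case i of Inl k \<Rightarrow> u $ k | Inr k \<Rightarrow> v $ k)"

lemma join_nth [simp]: "join u v $ Inl k = u $ k" "join u v $ Inr l = v $ l"
  by (simp_all add: join_def)

lemma all_sum_type: "(\<forall>i :: 'n + 'm. P i) \<longleftrightarrow> (\<forall>k. P (Inl k)) \<and> (\<forall>l. P (Inr l))"
  by (metis sum.exhaust)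

lemma join_eq_iff [simp]: "join u v = join u' v' \<longleftrightarrow> u = u' \<and> v = v'"
  by (simp add: vec_eq_iff all_sum_type)

lemma join_exhaust: obtains u v where "x = join u v"
proof
  show "x = join (\<chi> k. x $ Inl k) (\<chi> k. x $ Inr k)"
    by (simp add: vec_eq_iff all_sum_type)
qed

lemma join_arith:
  "join u v + join u' v' = join (u + u') (v + v')"
  "join u v - join u' v' = join (u - u') (v - v')"
  "- join u v = join (- u) (- v)"
  "c *s join w w' = join (c *s w) (c *s w')"
  by (simp_all add: vec_eq_iff all_sum_type)

lemma sum_sum_type:
  "(\<Sum>i\<in>(UNIV :: ('n::finite + 'm::finite) set). f i) = (\<Sum>k\<in>UNIV. f (Inl k)) + (\<Sum>l\<in>UNIV. f (Inr l))"
  by (simp add: sum.Plus flip: UNIV_Plus_UNIV)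

lemma block_matrix_mult_vec:
  "block_matrix P Q S T *v join u v = join (P *v u + Q *v v) (S *v u + T *v v)"
  by (simp add: vec_eq_iff all_sum_type block_matrix_def matrix_vector_mult_def sum_sum_type)

definition swap_blocks :: "'a^('n::finite + 'n) \<Rightarrow> 'a^('n + 'n)" where
  "swap_blocks x = (\<chi> i. x $ (case i of Inl k \<Rightarrow> Inr k | Inr k \<Rightarrow> Inl k))"

lemma swap_blocks_join [simp]: "swap_blocks (join u v) = join v u"
  by (simp add: vec_eq_iff all_sum_type swap_blocks_def)

lemma swap_blocks_swap_blocks [simp]: "swap_blocks (swap_blocks x) = x"
  by (simp add: vec_eq_iff all_sum_type swap_blocks_def)

lemma swap_blocks_arith:
  "swap_blocks (x + y) = swap_blocks x + swap_blocks y"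
  "swap_blocks (x - y) = swap_blocks x - swap_blocks y"
  "swap_blocks (- x) = - swap_blocks x"
  "swap_blocks (c *s w) = c *s swap_blocks w"
  "swap_blocks 0 = 0"
  by (simp_all add: vec_eq_iff all_sum_type swap_blocks_def)

lemma swap_blocks_eq_0_iff [simp]: "swap_blocks x = 0 \<longleftrightarrow> x = 0"
  by (metis swap_blocks_swap_blocks swap_blocks_arith(5))

lemma linear_swap_blocks:
  "Vector_Spaces.linear (*s) (*s) (swap_blocks :: 'a::field^('n::finite + 'n) \<Rightarrow> _)"
  by unfold_locales (simp_all add: swap_blocks_arith vector_add_ldistrib vector_sadd_rdistrib)

text \<open>A real basis of the range of \<open>M\<close> remains a basis over the complex numbers:
  a complex relation splits into its real and imaginary parts, and so does the image of a complex
  vector.\<close>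

lemma dim_range_cmat:
  fixes M :: "real^'n^'m"
  shows "vec.dim (range ((*v) (cmat M))) = rank M"
proof -
  define c :: "real^'m \<Rightarrow> complex^'m" where "c x = (\<chi> i. of_real (x $ i))" for x
  have c_add: "c (x + y) = c x + c y" and c_scale: "c (r *\<^sub>R x) = of_real r *s c x"
    and c_0: "c 0 = 0" for x y r
    by (simp_all add: c_def vec_eq_iff)
  have "inj c" by (auto simp: c_def inj_def vec_eq_iff)
  obtain E where E: "E \<subseteq> range ((*v) M)" "independent E" "range ((*v) M) \<subseteq> span E"
    "card E = dim (range ((*v) M))"
    using basis_exists by blast
  have "finite E" using E(2) by (rule independent_imp_finite)
  have cM: "cmat M *v (\<chi> i. of_real (u $ i)) = c (M *v u)" for u
    by (simp add: c_def vec_eq_iff matrix_vector_mult_def)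
  have span: "c x \<in> vec.span (c ` E)" if "x \<in> span E" for x
    using that
  proof (induction rule: span_induct_alt)
    case base
    then show ?case by (simp add: c_0 vec.span_zero)
  next
    case (step r x y)
    then show ?case
      by (simp add: c_add c_scale vec.span_add vec.span_scale vec.span_base)
  qed
  have "range ((*v) (cmat M)) \<subseteq> vec.span (c ` E)"
  proof clarify
    fix w :: "complex^'n"
    define p q :: "real^'n" where "p = (\<chi> i. Re (w $ i))" and "q = (\<chi> i. Im (w $ i))"
    have "w = (\<chi> i. of_real (p $ i)) + \<i> *s (\<chi> i. of_real (q $ i))"
      by (simp add: vec_eq_iff p_def q_def complex_eq)
    then have "cmat M *v w = c (M *v p) + \<i> *s c (M *v q)"
      by (simp add: vec.add vec.scale cM)
    moreover have "M *v u \<in> span E" for u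
      using E(3) by blast
    ultimately show "cmat M *v w \<in> vec.span (c ` E)"
      by (simp add: span vec.span_add vec.span_scale)
  qed
  moreover have "c ` E \<subseteq> range ((*v) (cmat M))"
    using E(1) cM by (auto simp: image_iff subset_iff) metis
  moreover have "vec.independent (c ` E)"
  proof
    assume "vec.dependent (c ` E)"
    then obtain u b where b: "b \<in> E" "u (c b) \<noteq> 0" "(\<Sum>v\<in>c ` E. u v *s v) = 0"
      using vec.dependent_finite[of "c ` E"] \<open>finite E\<close> by auto
    have sum: "(\<Sum>e\<in>E. u (c e) * of_real (e $ i)) = 0" for i
      using b(3) \<open>inj c\<close>
      by (simp add: sum.reindex inj_on_def inj_def vec_eq_iff c_def)
    have "(\<Sum>e\<in>E. Re (u (c e)) *\<^sub>R e) = 0" "(\<Sum>e\<in>E. Im (u (c e)) *\<^sub>R e) = 0"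
      using arg_cong[OF sum, of Re] arg_cong[OF sum, of Im] by (simp_all add: vec_eq_iff)
    then have "Re (u (c b)) = 0" "Im (u (c b)) = 0"
      using E(2) b(1) \<open>finite E\<close> by (auto simp: dependent_finite)
    then show False using b(2) by (simp add: complex_eq_iff)
  qed
  moreover have "card (c ` E) = rank M"
    using \<open>inj c\<close> E(4) by (simp add: card_image inj_on_def inj_def rank_dim_range)
  ultimately show ?thesis by (intro vec.dim_unique)
qed

lemma neg_inv_neg_inv: "neg_inv (neg_inv S) = S"
  by (force simp: neg_inv_def)

lemma block_matrix_simps:
  "block_matrix P Q S T $ Inl k $ Inl l = P $ k $ l"
  "block_matrix P Q S T $ Inl k $ Inr m = Q $ k $ m"
  "block_matrix P Q S T $ Inr n $ Inl l = S $ n $ l"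
  "block_matrix P Q S T $ Inr n $ Inr m = T $ n $ m"
  by (simp_all add: block_matrix_def)

text \<open>\<open>\<beta>\<close> is a free parameter: setting it to 0 turns facts about
  \<open>A\<close> into facts about \<open>\<Omega>\<close>. The assumptions are symmetric in
  \<open>\<alpha>\<close> and \<open>\<eta>\<close>, so every fact has a dual instance.\<close>

locale pencil =
  fixes \<alpha> \<eta> \<theta> R :: "real^'n^'n" and \<beta> :: real
  assumes pos_def_\<alpha>: "pos_def \<alpha>" and pos_def_\<eta>: "pos_def \<eta>"
    and skew: "transpose \<theta> = - \<theta>" and psd_R: "pos_semidef R"
begin

abbreviation "K \<equiv> psd_sqrt \<alpha>"
abbreviation "K' \<equiv> matrix_inv (psd_sqrt \<alpha>)"
abbreviation "L \<equiv> psd_sqrt \<eta>"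
abbreviation "L' \<equiv> matrix_inv (psd_sqrt \<eta>)"
abbreviation "G \<equiv> 2 *\<^sub>R \<theta> + \<beta> *\<^sub>R R"

abbreviation "A \<equiv> Amat \<alpha> \<eta> \<theta> R \<beta>"
abbreviation "A_dual \<equiv> Amat \<eta> \<alpha> \<theta> R \<beta>"
abbreviation "\<Omega> \<equiv> Omega \<alpha> \<eta> \<theta>"
abbreviation "B \<equiv> Bmat \<alpha> R"

lemma transpose_Phi: "transpose (Phi \<alpha> \<eta>) = K' ** L"
  by (simp add: Phi_def matrix_transpose_mul transpose_inv_psd_sqrt transpose_psd_sqrt
      pos_def_\<alpha> pos_def_\<eta>)

lemma A_mult_join:
  "A *v join u v = join (- \<i> *s (cmat (K' ** G ** K') *v u) - \<i> *s (cmat (K' ** L) *v v))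
     (\<i> *s (cmat (L ** K') *v u))"
proof -
  have "K' ** G ** K' = 2 *\<^sub>R (K' ** \<theta> ** K') + \<beta> *\<^sub>R (K' ** R ** K')"
    by (simp add: matrix_eq matrix_vector_mult_add_rdistrib matrix_vector_right_distrib
        matrix_vector_mult_scaleR
        flip: matrix_vector_mul_assoc scaleR_matrix_vector_assoc)
  then have "cmat (K' ** G ** K') *v u = 2 *s (cmat (K' ** \<theta> ** K') *v u) +
      of_real \<beta> *s (cmat (K' ** R ** K') *v u)"
    by (simp add: vec_eq_iff matrix_vector_mult_def sum_distrib_left sum.distrib algebra_simps)
  then show ?thesis
    unfolding Amat_def Omega_def Bmat_def transpose_Phi matrix_vector_mult_diff_rdistrib
      block_matrix_mult_vec map_matrix_mult_vec
    by (simp add: Phi_def join_arith vector_add_ldistrib vector_smult_assoc)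
qed

end

section \<open>The pencil and its dual\<close>

context pencil begin

lemma dual: "pencil \<eta> \<alpha> \<theta> R"
  by unfold_locales (rule pos_def_\<eta> pos_def_\<alpha> skew psd_R)+

lemma Amat_0: "Amat \<alpha> \<eta> \<theta> R 0 = \<Omega>"
  by (simp add: Amat_def vec_eq_iff)

text \<open>The duality \<open>A_dual = - P A^-1 P\<close>, written as
  \<open>A P A_dual = - P\<close> without an inverse. In block form the two terms containing
  \<open>G\<close> both reduce to \<open>K' G L'\<close> and cancel.\<close>

lemma A_mult_swap_A_dual: "A *v swap_blocks (A_dual *v x) = - swap_blocks x"
proof -
  have inv: "K' ** K = mat 1" "K ** K' = mat 1" "L' ** L = mat 1" "L ** L' = mat 1"
    by (simp_all add: psd_sqrt_inv_left psd_sqrt_inv_right pos_def_\<alpha> pos_def_\<eta>)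
  have "K' ** G ** K' ** (K ** L') = K' ** G ** (K' ** K) ** L'"
    "K' ** L ** (L' ** G ** L') = K' ** (L ** L') ** G ** L'"
    "K' ** L ** (L' ** K) = K' ** (L ** L') ** K"
    "L ** K' ** (K ** L') = L ** (K' ** K) ** L'"
    by (simp_all only: matrix_mul_assoc)
  then have cancel: "K' ** G ** K' ** (K ** L') = K' ** L ** (L' ** G ** L')"
    "K' ** L ** (L' ** K) = mat 1" "L ** K' ** (K ** L') = mat 1"
    by (simp_all add: inv)
  obtain u v where x: "x = join u v" by (rule join_exhaust)
  show ?thesis
    unfolding x A_mult_join pencil.A_mult_join[OF dual] swap_blocks_join join_arith
    by (simp add: vec.add vec.diff vec.scale cmat_mult_vec cancel vector_smult_assoc cmat_mat_1
        vector_ssub_ldistrib vec.neg)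
qed

lemma eigenvector_dual:
  assumes "A_dual *v x = z *s x" "x \<noteq> 0"
  shows "z \<noteq> 0" "A *v swap_blocks x = - inverse z *s swap_blocks x"
proof -
  have eq: "z *s (A *v swap_blocks x) = - swap_blocks x"
    using A_mult_swap_A_dual[of x] assms(1) by (simp add: swap_blocks_arith vec.scale)
  then show z: "z \<noteq> 0" using assms(2) by auto
  have "A *v swap_blocks x = inverse z *s (z *s (A *v swap_blocks x))"
    using z by (simp add: vector_smult_assoc)
  then show "A *v swap_blocks x = - inverse z *s swap_blocks x"
    unfolding eq by simp
qed

lemma neg_inv_spectrum_dual_subset: "neg_inv (spectrum A_dual) \<subseteq> spectrum A"
proof -
  have "- inverse z \<in> spectrum A" if "A_dual *v x = z *s x" "x \<noteq> 0" for z x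
    unfolding spectrum_eq mem_Collect_eq
    by (rule exI[of _ "swap_blocks x"]) (simp only: eigenvector_dual[OF that] swap_blocks_eq_0_iff that simp_thms)
  then show ?thesis by (auto simp: neg_inv_def spectrum_eq)
qed

lemma zero_notin_spectrum: "0 \<notin> spectrum A"
proof
  assume "0 \<in> spectrum A"
  then obtain v where "v \<noteq> 0" "A *v v = 0 *s v" by (auto simp: spectrum_eq)
  then show False using pencil.eigenvector_dual(1)[OF dual] by blast
qed

text \<open>One factor is transported at a time: from
  \<open>A P (A_dual - z) = - z (A + 1/z) P\<close>, the vector \<open>(A + 1/z) P x\<close> is a
  multiple of \<open>A\<close> applied to a vector covered by induction.\<close>

lemma gen_eigenspace_dual_subset:
  assumes "0 \<notin> S" "x \<in> gen_eigenspace A_dual S"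
  shows "swap_blocks x \<in> gen_eigenspace A (neg_inv S)"
  using assms(2)
proof (induction rule: gen_eigenspace.induct)
  case zero
  then show ?case by (simp add: swap_blocks_arith gen_eigenspace.zero)
next
  case (step z x)
  have "z \<noteq> 0" using step assms(1) by auto
  let ?y = "swap_blocks x"
  have "A *v swap_blocks (A_dual *v x - z *s x) = - ?y - z *s (A *v ?y)"
    by (simp add: swap_blocks_arith vec.diff vec.scale A_mult_swap_A_dual)
  also have "\<dots> = - z *s (A *v ?y - (- inverse z) *s ?y)"
    using \<open>z \<noteq> 0\<close> by (simp add: vector_ssub_ldistrib vector_smult_assoc vector_add_ldistrib)
  finally have eq: "A *v ?y - (- inverse z) *s ?y =
      (- inverse z) *s (A *v swap_blocks (A_dual *v x - z *s x))"
    using \<open>z \<noteq> 0\<close> by (simp add: vector_smult_assoc)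
  have "A *v ?y - (- inverse z) *s ?y \<in> gen_eigenspace A (neg_inv S)"
    unfolding eq using step.IH by (intro gen_eigenspace_scale gen_eigenspace_mult)
  moreover have "- inverse z \<in> neg_inv S" using step by (auto simp: neg_inv_def)
  ultimately show ?case by (metis gen_eigenspace.step)
qed

section \<open>Conjugation symmetry, self-adjointness, and the rank of the loss matrix\<close>

lemma Amat_mult_cnj: "A *v (\<chi> i. cnj (x $ i)) = - (\<chi> i. cnj ((A *v x) $ i))"
proof -
  have "cnj (A $ i $ j) = - A $ i $ j" for i j
    by (cases i; cases j) (simp_all add: Amat_def Omega_def Bmat_def block_matrix_simps)
  then show ?thesis
    by (simp add: vec_eq_iff matrix_vector_mult_def sum_negf)
qed

lemma neg_cnj_spectrum_subset: "neg_cnj (spectrum A) \<subseteq> spectrum A"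
proof -
  have "- cnj z \<in> spectrum A" if "A *v v = z *s v" "v \<noteq> 0" for z v
  proof -
    let ?w = "\<chi> i. cnj (v $ i)"
    have "A *v ?w = - cnj z *s ?w"
      unfolding Amat_mult_cnj that(1) by (simp add: vec_eq_iff)
    moreover have "?w \<noteq> 0" using that(2) by (simp add: vec_eq_iff)
    ultimately show ?thesis by (auto simp: spectrum_eq)
  qed
  then show ?thesis by (auto simp: neg_cnj_def spectrum_eq)
qed

lemma Omega_selfadjoint: "(\<Omega> *v x) \<bullet> y = x \<bullet> (\<Omega> *v y)"
proof (rule hermitian_selfadjoint)
  have trans: "transpose (K' ** \<theta> ** K') = - (K' ** \<theta> ** K')"
  proof -
    have neg: "(- M) *v y = - (M *v y)" for M :: "real^'n^'n" and y
      by (simp add: vec_eq_iff matrix_vector_mult_def sum_negf)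
    have "transpose (K' ** \<theta> ** K') = K' ** ((- \<theta>) ** K')"
      by (simp add: matrix_transpose_mul transpose_inv_psd_sqrt pos_def_\<alpha> skew)
    then show ?thesis
      by (simp add: matrix_eq neg vec.neg flip: matrix_vector_mul_assoc)
  qed
  have entry: "(K' ** \<theta> ** K') $ j $ i = - (K' ** \<theta> ** K') $ i $ j" for i j
    using arg_cong[OF trans, of "\<lambda>M. M $ i $ j"] by (simp add: transpose_def)
  show "\<Omega> $ i $ j = cnj (\<Omega> $ j $ i)" for i j
  proof (cases i; cases j)
    fix k l assume "i = Inl k" "j = Inl l"
    then show ?thesis
      using entry[of k l] by (simp add: Omega_def block_matrix_simps)
  qed (simp_all add: Omega_def block_matrix_simps transpose_def)
qed

lemma transpose_loss: "transpose (K' ** R ** K') = K' ** R ** K'"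
  using psd_R by (simp add: matrix_transpose_mul transpose_inv_psd_sqrt pos_def_\<alpha>
      matrix_mul_assoc pos_semidef_def)

lemma B_selfadjoint: "(B *v x) \<bullet> y = x \<bullet> (B *v y)"
proof (rule hermitian_selfadjoint)
  show "B $ i $ j = cnj (B $ j $ i)" for i j
  proof (cases i; cases j)
    fix k l assume "i = Inl k" "j = Inl l"
    then show ?thesis
      using arg_cong[OF transpose_loss, of "\<lambda>M. M $ k $ l"]
      by (simp add: Bmat_def block_matrix_simps transpose_def)
  qed (simp_all add: Bmat_def block_matrix_simps)
qed

lemma B_mult_join: "B *v join u v = join (cmat (K' ** R ** K') *v u) 0"
  by (simp add: Bmat_def block_matrix_mult_vec)

lemma B_nonneg: "0 \<le> x \<bullet> (B *v x)"
proof -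
  let ?M = "K' ** R ** K'"
  have psd: "0 \<le> p \<bullet> (?M *v p)" for p
  proof -
    have "p \<bullet> (?M *v p) = (K' *v p) \<bullet> (R *v (K' *v p))"
      by (simp add: symmetric_selfadjoint transpose_inv_psd_sqrt pos_def_\<alpha>
          flip: matrix_vector_mul_assoc)
    then show ?thesis using psd_R by (simp add: pos_semidef_def)
  qed
  obtain u v where x: "x = join u v" by (rule join_exhaust)
  define p q where "p = (\<chi> i. Re (u $ i))" and "q = (\<chi> i. Im (u $ i))"
  have "x \<bullet> (B *v x) = u \<bullet> (cmat ?M *v u)"
    by (simp add: x B_mult_join inner_vec_def sum_sum_type)
  \<comment> \<open>The block is real and \<open>inner\<close> is a real part, so the form acts
    separately on the real and imaginary parts of \<open>u\<close>.\<close>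
  also have "\<dots> = p \<bullet> (?M *v p) + q \<bullet> (?M *v q)"
    by (simp add: inner_vec_def inner_complex_def matrix_vector_mult_def p_def q_def sum.distrib)
  finally show ?thesis using psd[of p] psd[of q] by simp
qed

lemma dim_range_B: "vec.dim (range ((*v) B)) = rank R"
proof -
  let ?M = "K' ** R ** K'"
  let ?j = "\<lambda>u :: complex^'n. join u (0 :: complex^'n)"
  have lin: "Vector_Spaces.linear (*s) (*s) ?j"
    by unfold_locales
      (simp_all add: join_arith vector_add_ldistrib vector_sadd_rdistrib)
  have "range ((*v) B) = ?j ` range ((*v) (cmat ?M))"
  proof safe
    fix x :: "complex^('n + 'n)"
    obtain u v where x: "x = join u v" by (rule join_exhaust)
    show "B *v x \<in> ?j ` range ((*v) (cmat ?M))"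
      unfolding x B_mult_join by blast
  next
    fix u
    show "?j (cmat ?M *v u) \<in> range ((*v) B)"
      unfolding B_mult_join[of u 0, symmetric] by blast
  qed
  also have "vec.dim \<dots> = vec.dim (range ((*v) (cmat ?M)))"
    by (rule vec.dim_image_eq[OF lin]) (simp add: inj_on_def)
  also have "\<dots> = rank ?M" by (rule dim_range_cmat)
  also have "\<dots> = rank R"
  proof (rule antisym)
    show "rank ?M \<le> rank R"
      by (rule le_trans[OF rank_mul_le_left rank_mul_le_right])
    have "K ** ?M ** K = (K ** K') ** R ** (K' ** K)"
      by (simp only: matrix_mul_assoc)
    then have "K ** ?M ** K = R"
      by (simp add: psd_sqrt_inv_left psd_sqrt_inv_right pos_def_\<alpha>)
    moreover have "rank (K ** ?M ** K) \<le> rank ?M"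
      by (rule le_trans[OF rank_mul_le_left rank_mul_le_right])
    ultimately show "rank R \<le> rank ?M" by simp
  qed
  finally show ?thesis .
qed

text \<open>One inclusion applied to the dual pencil yields the other, since \<open>neg_inv\<close>
  is an involution.\<close>

lemma spectrum_eq_neg_inv: "spectrum A = neg_inv (spectrum A_dual)"
proof
  have "neg_inv (neg_inv (spectrum A)) \<subseteq> neg_inv (spectrum A_dual)"
    using pencil.neg_inv_spectrum_dual_subset[OF dual] unfolding neg_inv_def by blast
  then show "spectrum A \<subseteq> neg_inv (spectrum A_dual)" by (simp only: neg_inv_neg_inv)
qed (rule neg_inv_spectrum_dual_subset)

lemma spectrum_eq_neg_cnj: "spectrum A = neg_cnj (spectrum A)"
proof
  have "neg_cnj (neg_cnj (spectrum A)) \<subseteq> neg_cnj (spectrum A)"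
    using neg_cnj_spectrum_subset unfolding neg_cnj_def by blast
  then show "spectrum A \<subseteq> neg_cnj (spectrum A)" by (simp add: neg_cnj_def image_image)
qed (rule neg_cnj_spectrum_subset)

lemma swap_gen_eigenspace:
  assumes "0 \<notin> S"
  shows "swap_blocks ` gen_eigenspace A_dual S = gen_eigenspace A (neg_inv S)"
proof
  have "0 \<notin> neg_inv S" using assms by (auto simp: neg_inv_def)
  from pencil.gen_eigenspace_dual_subset[OF dual this]
  have "x \<in> gen_eigenspace A (neg_inv S) \<Longrightarrow> swap_blocks x \<in> gen_eigenspace A_dual S" for x
    by (simp add: neg_inv_neg_inv)
  then show "gen_eigenspace A (neg_inv S) \<subseteq> swap_blocks ` gen_eigenspace A_dual S"
    by (metis image_eqI subsetI swap_blocks_swap_blocks)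
qed (use gen_eigenspace_dual_subset[OF assms] in blast)

lemma dim_gen_eigenspace_dual:
  assumes "0 \<notin> S"
  shows "vec.dim (gen_eigenspace A (neg_inv S)) = vec.dim (gen_eigenspace A_dual S)"
proof -
  have "inj_on swap_blocks (vec.span (gen_eigenspace A_dual S))"
    by (metis inj_onI swap_blocks_swap_blocks)
  from vec.dim_image_eq[OF linear_swap_blocks this] show ?thesis
    by (simp add: swap_gen_eigenspace[OF assms])
qed

section \<open>Extremal eigenvalues of \<open>\<Omega>\<close>\<close>

lemma omega_max_props:
  obtains E \<mu> where "selfadjoint_eigenbasis ((*v) \<Omega>) E \<mu>" "E \<noteq> {}"
    "\<And>b. b \<in> E \<Longrightarrow> \<bar>\<mu> b\<bar> \<le> omega_max \<alpha> \<eta> \<theta>" "omega_max \<alpha> \<eta> \<theta> \<in> \<mu> ` E"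
proof -
  obtain E \<mu> where E: "selfadjoint_eigenbasis ((*v) \<Omega>) E \<mu>"
    using selfadjoint_eigenbasis_exists[OF linear_complex_matrix Omega_selfadjoint] by blast
  interpret E: selfadjoint_eigenbasis "(*v) \<Omega>" E \<mu> by (rule E)
  have spec: "spectrum \<Omega> = complex_of_real ` \<mu> ` E"
    by (rule spectrum_selfadjoint[OF E])
  have max: "omega_max \<alpha> \<eta> \<theta> = Max (\<mu> ` E)"
    unfolding omega_max_def spec by (rule arg_cong[of _ _ Max]) auto
  have "join 1 0 \<noteq> (0 :: complex^('n + 'n))"
    by (simp add: vec_eq_iff all_sum_type)
  then have ne: "E \<noteq> {}" by (rule E.basis_nonempty)
  \<comment> \<open>The eigenvalues are real and the spectrum is stable under
    \<open>z \<mapsto> - cnj z\<close>, so with \<open>\<mu> b\<close> also \<open>- \<mu> b\<close>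
    is an eigenvalue. Hence the largest eigenvalue bounds all moduli.\<close>
  have "\<bar>\<mu> b\<bar> \<le> Max (\<mu> ` E)" if "b \<in> E" for b
  proof -
    have "complex_of_real (\<mu> b) \<in> spectrum \<Omega>" using that by (simp add: spec)
    then have "- cnj (complex_of_real (\<mu> b)) \<in> neg_cnj (spectrum \<Omega>)"
      unfolding neg_cnj_def by (rule imageI)
    then have "- cnj (complex_of_real (\<mu> b)) \<in> spectrum \<Omega>"
      using pencil.neg_cnj_spectrum_subset[OF pencil_axioms, where \<beta> = 0]
      unfolding Amat_0 by blast
    then have "- \<mu> b \<in> \<mu> ` E"
      unfolding spec by (metis (no_types, lifting) complex_cnj_complex_of_real image_iff of_real_eq_iff of_real_minus)
    then show ?thesis
      using that E.finite_basis by (auto simp: abs_le_iff)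
  qed
  moreover have "Max (\<mu> ` E) \<in> \<mu> ` E"
    using ne E.finite_basis by simp
  ultimately show ?thesis using that[OF E ne] by (simp add: max)
qed

lemma
  shows omega_max_bound: "z \<in> spectrum \<Omega> \<Longrightarrow> cmod z \<le> omega_max \<alpha> \<eta> \<theta>"
    and omega_max_in: "complex_of_real (omega_max \<alpha> \<eta> \<theta>) \<in> spectrum \<Omega>"
    and omega_max_pos: "omega_max \<alpha> \<eta> \<theta> > 0"
    and finite_spectrum_Omega: "finite (spectrum \<Omega>)"
proof -
  obtain E \<mu> where E: "selfadjoint_eigenbasis ((*v) \<Omega>) E \<mu>" "E \<noteq> {}"
    "\<And>b. b \<in> E \<Longrightarrow> \<bar>\<mu> b\<bar> \<le> omega_max \<alpha> \<eta> \<theta>" "omega_max \<alpha> \<eta> \<theta> \<in> \<mu> ` E"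
    using omega_max_props by blast
  have spec: "spectrum \<Omega> = complex_of_real ` \<mu> ` E"
    by (rule spectrum_selfadjoint[OF E(1)])
  show "z \<in> spectrum \<Omega> \<Longrightarrow> cmod z \<le> omega_max \<alpha> \<eta> \<theta>"
    using E(3) by (auto simp: spec)
  show "finite (spectrum \<Omega>)"
    using selfadjoint_eigenbasis.finite_basis[OF E(1)] by (simp add: spec)
  show in_spec: "complex_of_real (omega_max \<alpha> \<eta> \<theta>) \<in> spectrum \<Omega>"
    using E(4) by (simp add: spec)
  obtain b where "b \<in> E" using E(2) by blast
  then have "omega_max \<alpha> \<eta> \<theta> \<ge> 0" using E(3)[of b] by simp
  moreover have "omega_max \<alpha> \<eta> \<theta> \<noteq> 0"
    using in_spec pencil.zero_notin_spectrum[OF pencil_axioms, where \<beta> = 0] unfolding Amat_0 by auto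
  ultimately show "omega_max \<alpha> \<eta> \<theta> > 0" by simp
qed

lemma norm_Omega_mult: "norm (\<Omega> *v x) \<le> omega_max \<alpha> \<eta> \<theta> * norm x"
proof -
  obtain E \<mu> where E: "selfadjoint_eigenbasis ((*v) \<Omega>) E \<mu>" "E \<noteq> {}"
    "\<And>b. b \<in> E \<Longrightarrow> \<bar>\<mu> b\<bar> \<le> omega_max \<alpha> \<eta> \<theta>"
    using omega_max_props by blast
  interpret E: selfadjoint_eigenbasis "(*v) \<Omega>" E \<mu> by (rule E)
  have "(norm (\<Omega> *v x))\<^sup>2 \<le> (omega_max \<alpha> \<eta> \<theta> * norm x)\<^sup>2"
    unfolding E.norm_image power_mult_distrib E.norm_expansion[of x] sum_distrib_left
    using E(3) omega_max_pos by (intro sum_mono mult_right_mono) (auto simp: abs_le_square_iff[symmetric])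
  then show ?thesis
    by (rule power2_le_imp_le) (simp add: omega_max_pos less_imp_le)
qed

text \<open>Spectral duality at \<open>\<beta> = 0\<close>: the least modulus for
  \<open>\<Omega>\<close> is the reciprocal of the largest one for its dual.\<close>

lemma omega_min_eq: "omega_min \<alpha> \<eta> \<theta> = inverse (omega_max \<eta> \<alpha> \<theta>)"
proof -
  have spec: "spectrum \<Omega> = neg_inv (spectrum (Omega \<eta> \<alpha> \<theta>))"
    using pencil.spectrum_eq_neg_inv[OF pencil_axioms, where \<beta> = 0] by (simp only: Amat_0 pencil.Amat_0[OF dual])
  have nz: "0 \<notin> spectrum (Omega \<eta> \<alpha> \<theta>)"
    using pencil.zero_notin_spectrum[OF dual, where \<beta> = 0] unfolding pencil.Amat_0[OF dual] .
  let ?w = "omega_max \<eta> \<alpha> \<theta>"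
  have "?w > 0" by (rule pencil.omega_max_pos[OF dual])
  show ?thesis
    unfolding omega_min_def
  proof (rule Min_eqI)
    show "finite (cmod ` spectrum \<Omega>)" by (simp add: finite_spectrum_Omega)
    show "inverse ?w \<in> cmod ` spectrum \<Omega>"
      using pencil.omega_max_in[OF dual] \<open>?w > 0\<close> unfolding spec neg_inv_def
      by (force simp: norm_inverse)
  next
    fix y assume "y \<in> cmod ` spectrum \<Omega>"
    then obtain z where z: "z \<in> spectrum (Omega \<eta> \<alpha> \<theta>)" "y = inverse (cmod z)"
      by (auto simp: spec neg_inv_def norm_inverse)
    with nz have "z \<noteq> 0" by auto
    with z pencil.omega_max_bound[OF dual z(1)] show "inverse ?w \<le> y"
      by (simp add: le_imp_inverse_le)
  qed
qed

lemma omega_min_le_omega_max: "omega_min \<alpha> \<eta> \<theta> \<le> omega_max \<alpha> \<eta> \<theta>"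
proof -
  have "omega_min \<alpha> \<eta> \<theta> \<le> cmod (of_real (omega_max \<alpha> \<eta> \<theta>))"
    unfolding omega_min_def by (intro Min_le finite_imageI finite_spectrum_Omega imageI omega_max_in)
  then show ?thesis using omega_max_pos by simp
qed

end

section \<open>High-loss and low-loss subspaces\<close>

lemma isCont_swap_blocks: "isCont (swap_blocks :: complex^('n::finite + 'n) \<Rightarrow> _) x"
proof -
  have "linear (swap_blocks :: complex^('n + 'n) \<Rightarrow> _)"
    by (rule linearI) (simp_all add: swap_blocks_arith scaleR_eq_scalar_mult)
  then show ?thesis
    by (simp add: linear_continuous_at linear_conv_bounded_linear)
qed

lemma neg_inv_Int_cmod:
  "neg_inv (X \<inter> {z. P (cmod z)}) = neg_inv X \<inter> {z. P (inverse (cmod z))}"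
  by (auto simp: neg_inv_def norm_inverse)

lemma neg_cnj_Int_cmod: "neg_cnj (X \<inter> {z. P (cmod z)}) = neg_cnj X \<inter> {z. P (cmod z)}"
  by (auto simp: neg_cnj_def)

text \<open>The image is the disc without its centre; 0 has to be handled separately wherever this
  is compared with a full disc.\<close>

lemma neg_inv_outside_disc:
  assumes "c > 0"
  shows "neg_inv {z. cmod z > c} = {z. 0 < cmod z \<and> cmod z < inverse c}"
proof (intro set_eqI iffI)
  fix z assume "z \<in> {z. 0 < cmod z \<and> cmod z < inverse c}"
  then have "cmod (- inverse z) > c"
    using assms by (auto simp: norm_divide field_simps)
  moreover have "z = - inverse (- inverse z)" by simp
  ultimately show "z \<in> neg_inv {z. cmod z > c}" unfolding neg_inv_def by blast
qed (use assms in \<open>auto simp: neg_inv_def norm_inverse less_imp_inverse_less\<close>)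

lemma the_pair_eq: "(THE (x, y). x = a \<and> y = b) = (a, b)"
  by (rule the_equality) auto

text \<open>Carries the lower bound on \<open>\<beta>\<close> for one member of the dual pair; the
  other member is a second instance with \<open>\<alpha>\<close> and \<open>\<eta>\<close>
  exchanged.\<close>

locale overdamped = pencil \<alpha> \<eta> \<theta> R \<beta>
  for \<alpha> \<eta> \<theta> R :: "real^'n^'n" and \<beta> :: real +
  assumes rank_pos: "rank R > 0"
    and overdamped: "\<beta> > 2 * (omega_max \<alpha> \<eta> \<theta> / b_min \<alpha> R)"
begin

section \<open>Losses and localisation of the spectrum\<close>

lemma loss_eigenbasis:
  obtains E \<mu> where "selfadjoint_eigenbasis ((*v) B) E \<mu>" "nonzero_losses \<alpha> R = \<mu> ` E - {0}"
    "\<And>b. b \<in> E \<Longrightarrow> \<mu> b \<noteq> 0 \<Longrightarrow> b_min \<alpha> R \<le> \<mu> b" "b_min \<alpha> R > 0"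
proof -
  obtain E \<mu> where E: "selfadjoint_eigenbasis ((*v) B) E \<mu>"
    using selfadjoint_eigenbasis_exists[OF linear_complex_matrix B_selfadjoint] by blast
  interpret E: selfadjoint_eigenbasis "(*v) B" E \<mu> by (rule E)
  have spec: "spectrum B = complex_of_real ` \<mu> ` E"
    by (rule spectrum_selfadjoint[OF E])
  have losses: "nonzero_losses \<alpha> R = \<mu> ` E - {0}"
    by (auto simp: nonzero_losses_def spec)
  have fin: "finite (\<mu> ` E - {0})" using E.finite_basis by simp
  have nonneg: "\<mu> b \<ge> 0" if "b \<in> E" for b
    using B_nonneg[of b] that by (simp add: E.eigen E.norm_basis dot_square_norm)
  \<comment> \<open>Otherwise \<open>B\<close> vanishes, against \<open>rank R > 0\<close>. This
    makes \<open>b_min\<close> the minimum of a nonempty set.\<close>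
  have "\<mu> ` E - {0} \<noteq> {}"
  proof
    assume "\<mu> ` E - {0} = {}"
    then have "B *v x = 0" for x
      by (auto simp: E.eq_iff_coordinates[of "B *v x"] E.inner_image)
    then have "range ((*v) B) = {0}" by auto
    then show False using dim_range_B rank_pos by simp
  qed
  then have "b_min \<alpha> R \<in> \<mu> ` E - {0}"
    unfolding b_min_def losses using fin by (intro Min_in)
  then have "b_min \<alpha> R > 0" using nonneg by (auto simp: less_le)
  moreover have "b_min \<alpha> R \<le> \<mu> b" if "b \<in> E" "\<mu> b \<noteq> 0" for b
    unfolding b_min_def losses using fin that by (intro Min_le) auto
  ultimately show ?thesis using that[OF E losses] by blast
qed

lemma \<beta>_b_min: "\<beta> * b_min \<alpha> R > 2 * omega_max \<alpha> \<eta> \<theta>" "b_min \<alpha> R > 0" "\<beta> > 0"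
proof -
  show pos: "b_min \<alpha> R > 0" using loss_eigenbasis by blast
  then show "\<beta> * b_min \<alpha> R > 2 * omega_max \<alpha> \<eta> \<theta>"
    using overdamped by (simp add: field_simps)
  then have "\<beta> * b_min \<alpha> R > 0" using omega_max_pos by linarith
  then show "\<beta> > 0" using pos by (simp add: zero_less_mult_iff)
qed

lemma A_mult: "A *v x = \<Omega> *v x - (\<i> * of_real \<beta>) *s (B *v x)"
  by (simp add: Amat_def matrix_vector_mult_diff_rdistrib map_matrix_mult_vec)

text \<open>The Bauer--Fike estimate for the perturbation \<open>\<Omega>\<close> of the normal matrix \<open>- \<i> \<beta> B\<close>.\<close>

lemma spectrum_discs:
  assumes E: "selfadjoint_eigenbasis ((*v) B) E \<mu>" and z: "z \<in> spectrum A"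
  obtains b where "b \<in> E" "cmod (z + \<i> * of_real \<beta> * of_real (\<mu> b)) \<le> omega_max \<alpha> \<eta> \<theta>"
proof -
  interpret E: selfadjoint_eigenbasis "(*v) B" E \<mu> by (rule E)
  obtain x where x: "x \<noteq> 0" "A *v x = z *s x" using z by (auto simp: spectrum_eq)
  let ?w = "omega_max \<alpha> \<eta> \<theta>"
  let ?m = "\<lambda>b. cmod (z + \<i> * of_real \<beta> * of_real (\<mu> b))"
  \<comment> \<open>\<open>B\<close> is self-adjoint and commutes with multiplication by
    \<open>\<i>\<close>, which is skew for the real inner product.\<close>
  have orth: "x \<bullet> (\<i> *s (B *v x)) = 0"
  proof -
    have "x \<bullet> (\<i> *s (B *v x)) = x \<bullet> (B *v (\<i> *s x))" by (simp add: vec.scale)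
    also have "\<dots> = - (x \<bullet> (\<i> *s (B *v x)))"
      using inner_ii_mult[of x "B *v x"] by (metis B_selfadjoint inner_commute)
    finally show ?thesis by simp
  qed
  let ?y = "(\<i> * of_real \<beta>) *s (B *v x)"
  have y: "?y = \<beta> *\<^sub>R (\<i> *s (B *v x))"
    by (simp add: scaleR_eq_scalar_mult vector_smult_assoc mult.commute)
  have zx: "z *s x = Re z *\<^sub>R x + Im z *\<^sub>R (\<i> *s x)"
  proof -
    have "z = of_real (Re z) + of_real (Im z) * \<i>" by (simp add: complex_eq_iff)
    then have "z *s x = (of_real (Re z) + of_real (Im z) * \<i>) *s x" by (rule arg_cong)
    then show ?thesis
      by (simp only: scaleR_eq_scalar_mult vector_smult_assoc vector_sadd_rdistrib)
  qed
  have "(\<i> *s x) \<bullet> (\<i> *s (B *v x)) = x \<bullet> (B *v x)"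
    by (simp add: inner_ii_mult vector_smult_assoc)
  then have inner: "(z *s x) \<bullet> ?y = \<beta> * Im z * (x \<bullet> (B *v x))"
    unfolding y zx by (simp add: inner_add_left orth)
  \<comment> \<open>The eigenvalue equation reads
    \<open>\<Omega> x = z x + \<i> \<beta> B x\<close>. Expanded in the eigenbasis of
    \<open>B\<close>, the squared norm has weights \<open>|z + \<i> \<beta> \<mu> b|^2\<close>; if
    all of them exceeded \<open>omega_max\<close> squared, the norm bound for
    \<open>\<Omega>\<close> would fail.\<close>
  have "(norm (\<Omega> *v x))\<^sup>2 = (norm (z *s x + ?y))\<^sup>2"
    using x(2) by (simp add: A_mult algebra_simps)
  also have "\<dots> = (norm (z *s x))\<^sup>2 + (norm ?y)\<^sup>2 + 2 * ((z *s x) \<bullet> ?y)"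
    by (simp add: power2_norm_eq_inner inner_add_left inner_add_right inner_commute)
  also have "\<dots> = (cmod z)\<^sup>2 * (norm x)\<^sup>2 + \<beta>\<^sup>2 * (norm (B *v x))\<^sup>2 +
      2 * \<beta> * Im z * (x \<bullet> (B *v x))"
    by (simp add: inner norm_scalar_mult_vec power_mult_distrib norm_mult)
  also have "\<dots> = (\<Sum>b\<in>E. (?m b)\<^sup>2 * (b \<bullet> x)\<^sup>2)"
    unfolding E.norm_image E.norm_expansion[of x] E.inner_expansion[of x "B *v x"] sum_distrib_left
      sum.distrib[symmetric]
  proof (rule sum.cong[OF refl])
    fix b assume b: "b \<in> E"
    have "(?m b)\<^sup>2 = (cmod z)\<^sup>2 + \<beta>\<^sup>2 * (\<mu> b)\<^sup>2 + 2 * \<beta> * Im z * \<mu> b"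
      unfolding cmod_power2 by (simp add: power2_eq_square algebra_simps)
    then show "(cmod z)\<^sup>2 * (b \<bullet> x)\<^sup>2 + \<beta>\<^sup>2 * ((\<mu> b)\<^sup>2 * (b \<bullet> x)\<^sup>2) +
        2 * \<beta> * Im z * ((b \<bullet> x) * (b \<bullet> (B *v x))) = (?m b)\<^sup>2 * (b \<bullet> x)\<^sup>2"
      using b by (simp add: E.inner_image power2_eq_square algebra_simps)
  qed
  finally have eq: "(norm (\<Omega> *v x))\<^sup>2 = (\<Sum>b\<in>E. (?m b)\<^sup>2 * (b \<bullet> x)\<^sup>2)" .
  have "\<exists>b\<in>E. ?m b \<le> ?w"
  proof (rule ccontr)
    assume "\<not> ?thesis"
    then have gt: "?w\<^sup>2 < (?m b)\<^sup>2" if "b \<in> E" for b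
      using that omega_max_pos by (intro power_strict_mono) (auto simp: not_le)
    obtain b where b: "b \<in> E" "b \<bullet> x \<noteq> 0"
      using x(1) E.eq_iff_coordinates[of x 0] by auto
    have "(norm (\<Omega> *v x))\<^sup>2 \<le> (?w * norm x)\<^sup>2"
      by (rule power_mono[OF norm_Omega_mult]) simp
    also have "\<dots> = (\<Sum>b\<in>E. ?w\<^sup>2 * (b \<bullet> x)\<^sup>2)"
      by (simp add: power_mult_distrib E.norm_expansion[of x] sum_distrib_left)
    also have "\<dots> < (\<Sum>b\<in>E. (?m b)\<^sup>2 * (b \<bullet> x)\<^sup>2)"
    proof (rule sum_strict_mono_ex1[OF E.finite_basis])
      show "\<forall>b\<in>E. ?w\<^sup>2 * (b \<bullet> x)\<^sup>2 \<le> (?m b)\<^sup>2 * (b \<bullet> x)\<^sup>2"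
        using gt by (intro ballI mult_right_mono) (auto intro: less_imp_le)
      show "\<exists>b\<in>E. ?w\<^sup>2 * (b \<bullet> x)\<^sup>2 < (?m b)\<^sup>2 * (b \<bullet> x)\<^sup>2"
        using b gt by (intro bexI[of _ b] mult_strict_right_mono) auto
    qed
    finally show False using eq by simp
  qed
  then show ?thesis using that by blast
qed

text \<open>The centre has modulus at least \<open>\<beta> * b_min\<close>, and the radius is less
  than half of that.\<close>

lemma loss_disc_large:
  assumes "b_min \<alpha> R \<le> b" "cmod (z + \<i> * of_real \<beta> * of_real b) \<le> omega_max \<alpha> \<eta> \<theta>"
  shows "cmod z > \<beta> * b_min \<alpha> R / 2"
proof -
  have "\<beta> * b_min \<alpha> R \<le> \<beta> * b"
    using assms(1) \<beta>_b_min(3) by simp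
  also have "\<dots> = cmod (\<i> * of_real \<beta> * of_real b)"
    using assms(1) \<beta>_b_min by (simp add: norm_mult)
  also have "\<dots> \<le> cmod (z + \<i> * of_real \<beta> * of_real b) + cmod z"
    by (metis add_diff_cancel_left' norm_triangle_ineq4)
  finally show ?thesis using assms(2) \<beta>_b_min(1) by linarith
qed

text \<open>An eigenvalue outside the disc around 0 lies in the disc of a nonzero loss. So no
  modulus falls between \<open>omega_max\<close> and \<open>\<beta> * b_min / 2\<close>.\<close>

lemma spectrum_gap:
  assumes "z \<in> spectrum A" "cmod z > omega_max \<alpha> \<eta> \<theta>"
  shows "cmod z > \<beta> * b_min \<alpha> R / 2" "\<exists>b\<in>nonzero_losses \<alpha> R. z \<in> loss_disc \<alpha> \<eta> \<theta> \<beta> b"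
proof -
  obtain E \<mu> where E: "selfadjoint_eigenbasis ((*v) B) E \<mu>" "nonzero_losses \<alpha> R = \<mu> ` E - {0}"
    "\<And>b. b \<in> E \<Longrightarrow> \<mu> b \<noteq> 0 \<Longrightarrow> b_min \<alpha> R \<le> \<mu> b"
    using loss_eigenbasis by metis
  obtain b where b: "b \<in> E" "cmod (z + \<i> * of_real \<beta> * of_real (\<mu> b)) \<le> omega_max \<alpha> \<eta> \<theta>"
    by (rule spectrum_discs[OF E(1) assms(1)])
  with assms(2) have "\<mu> b \<noteq> 0" by auto
  with b E show "cmod z > \<beta> * b_min \<alpha> R / 2" "\<exists>b\<in>nonzero_losses \<alpha> R. z \<in> loss_disc \<alpha> \<eta> \<theta> \<beta> b"
    using loss_disc_large by (auto simp: loss_disc_def)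
qed

lemma sigma0_eq: "sigma0 \<alpha> \<eta> \<theta> R \<beta> = spectrum A \<inter> {z. cmod z \<le> omega_max \<alpha> \<eta> \<theta>}"
  by (simp add: sigma0_def loss_disc_def)

text \<open>Replaces the discs by a condition on the modulus, which is the form that
  \<open>neg_inv\<close> and \<open>neg_cnj\<close> transport.\<close>

lemma sigma1_eq: "sigma1 \<alpha> \<eta> \<theta> R \<beta> = spectrum A \<inter> {z. cmod z > omega_max \<alpha> \<eta> \<theta>}"
proof -
  have "cmod z > omega_max \<alpha> \<eta> \<theta>" if "b \<in> nonzero_losses \<alpha> R" "z \<in> loss_disc \<alpha> \<eta> \<theta> \<beta> b" for z b
  proof -
    obtain E \<mu> where E: "selfadjoint_eigenbasis ((*v) B) E \<mu>" "nonzero_losses \<alpha> R = \<mu> ` E - {0}"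
      "\<And>b. b \<in> E \<Longrightarrow> \<mu> b \<noteq> 0 \<Longrightarrow> b_min \<alpha> R \<le> \<mu> b"
      using loss_eigenbasis by metis
    then have "b_min \<alpha> R \<le> b" using that(1) by auto
    then have "cmod z > \<beta> * b_min \<alpha> R / 2"
      using loss_disc_large[of b z] that(2) by (simp add: loss_disc_def)
    then show ?thesis using \<beta>_b_min(1) by linarith
  qed
  then show ?thesis using spectrum_gap(2) by (auto simp: sigma1_def)
qed

text \<open>An indefinite form that \<open>A\<close> expands: its positive part lives on the range of \<open>B\<close>, its negative
  part on the kernel. It takes the place of a continuity argument in \<open>\<beta>\<close> for counting the
  eigenvalues of \<open>A\<close> on either side of the gap.\<close>

lemma expanded_form:
  defines "c \<equiv> \<beta> * b_min \<alpha> R / 2"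
  obtains F where "isCont F 0" "\<And>t x. F (t *\<^sub>R x) = t\<^sup>2 * F x"
    "\<And>x. x \<noteq> 0 \<Longrightarrow> c\<^sup>2 * F x < F (A *v x)"
    "\<And>y. F (B *v y) \<ge> 0" "\<And>x. B *v x = 0 \<Longrightarrow> F x \<le> 0"
proof -
  obtain E \<mu> where E: "selfadjoint_eigenbasis ((*v) B) E \<mu>"
    "\<And>b. b \<in> E \<Longrightarrow> \<mu> b \<noteq> 0 \<Longrightarrow> b_min \<alpha> R \<le> \<mu> b"
    using loss_eigenbasis by metis
  interpret E: selfadjoint_eigenbasis "(*v) B" E \<mu> by (rule E)
  define s :: "_ \<Rightarrow> real" where "s b = (if \<mu> b = 0 then - 1 else 1)" for b
  define F where "F x = (\<Sum>b\<in>E. s b * (b \<bullet> x)\<^sup>2)" for x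
  let ?w = "omega_max \<alpha> \<eta> \<theta>"
  have "isCont F 0"
    unfolding F_def by (intro continuous_intros)
  moreover have "F (t *\<^sub>R x) = t\<^sup>2 * F x" for t x
    by (simp add: F_def power_mult_distrib sum_distrib_left mult.left_commute)
  moreover have "c\<^sup>2 * F x < F (A *v x)" if "x \<noteq> 0" for x
  proof -
    \<comment> \<open>Absorbs the factor \<open>\<i>\<close>, so that the loss term becomes a real
      multiple of \<open>B ?u\<close> and can be read off in real coordinates.\<close>
    let ?u = "\<i> *s x"
    define y where "y = \<Omega> *v x"
    have Ax: "A *v x = y - \<beta> *\<^sub>R (B *v ?u)"
      by (simp add: A_mult y_def scaleR_eq_scalar_mult vector_smult_assoc vec.scale mult.commute)
    have "c\<^sup>2 * F x = (\<Sum>b\<in>E. c\<^sup>2 * s b * (b \<bullet> x)\<^sup>2)"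
      by (simp add: F_def sum_distrib_left mult.assoc)
    \<comment> \<open>Coefficientwise: on the kernel of \<open>B\<close> this is
      \<open>omega_max < c\<close>; elsewhere \<open>\<beta> * \<mu> b \<ge> 2 * c\<close> leaves a
      surplus \<open>c^2\<close>, which exceeds \<open>omega_max\<close> squared.\<close>
    also have "\<dots> < (\<Sum>b\<in>E. (\<beta>\<^sup>2 * (\<mu> b)\<^sup>2 / 2 - ?w\<^sup>2) * (b \<bullet> x)\<^sup>2)"
    proof (rule sum_strict_mono_ex1[OF E.finite_basis])
      have c: "?w\<^sup>2 < c\<^sup>2"
        using \<beta>_b_min(1) omega_max_pos by (intro power_strict_mono) (auto simp: c_def)
      have coeff: "c\<^sup>2 * s b < \<beta>\<^sup>2 * (\<mu> b)\<^sup>2 / 2 - ?w\<^sup>2" if b: "b \<in> E" for b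
      proof (cases "\<mu> b = 0")
        case True
        then show ?thesis using c by (simp add: s_def)
      next
        case False
        have "2 * c \<le> \<beta> * \<mu> b"
          using E(2)[OF b False] \<beta>_b_min(3) by (simp add: c_def)
        then have "(2 * c)\<^sup>2 \<le> (\<beta> * \<mu> b)\<^sup>2"
          using \<beta>_b_min by (intro power_mono) (auto simp: c_def)
        then have "2 * c\<^sup>2 \<le> \<beta>\<^sup>2 * (\<mu> b)\<^sup>2 / 2"
          by (simp add: power_mult_distrib)
        then show ?thesis using c False by (simp add: s_def)
      qed
      show "\<forall>b\<in>E. c\<^sup>2 * s b * (b \<bullet> x)\<^sup>2 \<le> (\<beta>\<^sup>2 * (\<mu> b)\<^sup>2 / 2 - ?w\<^sup>2) * (b \<bullet> x)\<^sup>2"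
        using coeff by (intro ballI mult_right_mono) (auto intro: less_imp_le)
      obtain b where "b \<in> E" "b \<bullet> x \<noteq> 0"
        using \<open>x \<noteq> 0\<close> E.eq_iff_coordinates[of x 0] by auto
      then show "\<exists>b\<in>E. c\<^sup>2 * s b * (b \<bullet> x)\<^sup>2 < (\<beta>\<^sup>2 * (\<mu> b)\<^sup>2 / 2 - ?w\<^sup>2) * (b \<bullet> x)\<^sup>2"
        using coeff by (intro bexI[of _ b] mult_strict_right_mono) auto
    qed
    also have "\<dots> = \<beta>\<^sup>2 / 2 * (norm (B *v x))\<^sup>2 - (?w * norm x)\<^sup>2"
      by (simp add: E.norm_image power_mult_distrib E.norm_expansion[of x] sum_distrib_left
          sum_subtractf algebra_simps)
    also have "\<dots> \<le> \<beta>\<^sup>2 / 2 * (norm (B *v ?u))\<^sup>2 - (norm y)\<^sup>2"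
      using power_mono[OF norm_Omega_mult[of x], of 2]
      by (simp add: y_def vec.scale norm_scalar_mult_vec)
    also have "\<dots> = (\<Sum>b\<in>E. \<beta>\<^sup>2 / 2 * (b \<bullet> (B *v ?u))\<^sup>2 - (b \<bullet> y)\<^sup>2)"
      unfolding E.norm_expansion sum_distrib_left sum_subtractf ..
    also have "\<dots> \<le> (\<Sum>b\<in>E. s b * (b \<bullet> (A *v x))\<^sup>2)"
    proof (rule sum_mono)
      fix b assume b: "b \<in> E"
      let ?p = "b \<bullet> y" and ?q = "\<beta> * (b \<bullet> (B *v ?u))"
      \<comment> \<open>Half of this square is the difference of the two sides of the next
        inequality. On the kernel \<open>?q = 0\<close>, and the required bound is an
        equality.\<close>
      have "0 \<le> (2 * ?p - ?q)\<^sup>2" by simp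
      then have "?q\<^sup>2 / 2 - ?p\<^sup>2 \<le> (?p - ?q)\<^sup>2"
        by (simp add: power2_eq_square algebra_simps)
      moreover have "?q = 0" if "\<mu> b = 0" using b that by (simp add: E.inner_image)
      ultimately have "?q\<^sup>2 / 2 - ?p\<^sup>2 \<le> s b * (?p - ?q)\<^sup>2"
        by (auto simp: s_def)
      then show "\<beta>\<^sup>2 / 2 * (b \<bullet> (B *v ?u))\<^sup>2 - (b \<bullet> y)\<^sup>2 \<le> s b * (b \<bullet> (A *v x))\<^sup>2"
        by (simp add: Ax inner_diff_right power_mult_distrib)
    qed
    finally show ?thesis by (simp add: F_def)
  qed
  moreover have "F (B *v y) \<ge> 0" for y
    unfolding F_def by (rule sum_nonneg) (simp add: s_def E.inner_image)
  moreover have "F x \<le> 0" if "B *v x = 0" for x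
  proof -
    have "\<mu> b * (b \<bullet> x) = 0" if "b \<in> E" for b
      using E.inner_image[OF that, of x] \<open>B *v x = 0\<close> by simp
    then show ?thesis
      unfolding F_def by (intro sum_nonpos) (auto simp: s_def)
  qed
  ultimately show ?thesis by (rule that)
qed

text \<open>\<open>F\<close> is positive on \<open>U\<close> and nonpositive on the kernel of
  \<open>B\<close>, so \<open>B\<close> is injective on \<open>U\<close>; \<open>F\<close> is
  negative on \<open>V\<close> and nonnegative on the range of \<open>B\<close>, so these meet in 0.
  The two resulting bounds are equalities because the dimensions of \<open>U\<close> and
  \<open>V\<close> add up to \<open>2 * CARD('n)\<close>.\<close>

lemma dim_spectral_subspaces:
  shows "vec.dim (gen_eigenspace A {z. cmod z > omega_max \<alpha> \<eta> \<theta>}) = rank R"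
    and "vec.dim (gen_eigenspace A {z. cmod z \<le> omega_max \<alpha> \<eta> \<theta>}) = 2 * CARD('n) - rank R"
    and "rank R \<le> 2 * CARD('n)"
proof -
  define c where "c = \<beta> * b_min \<alpha> R / 2"
  define V where "V = gen_eigenspace A {z. cmod z < c}"
  define U where "U = gen_eigenspace A {z. cmod z > c}"
  have c: "omega_max \<alpha> \<eta> \<theta> < c" "c > 0"
    using \<beta>_b_min(1) omega_max_pos by (auto simp: c_def)
  obtain F where F: "isCont F 0" "\<And>t x. F (t *\<^sub>R x) = t\<^sup>2 * F x"
    "\<And>x. x \<noteq> 0 \<Longrightarrow> c\<^sup>2 * F x < F (A *v x)"
    "\<And>y. F (B *v y) \<ge> 0" "\<And>x. B *v x = 0 \<Longrightarrow> F x \<le> 0"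
    unfolding c_def using expanded_form by metis
  have negative: "F x < 0" if "x \<in> V" "x \<noteq> 0" for x
    using expanding_form_negative[OF _ that(2) c(2) F(1-3)] that(1) by (simp add: V_def)
  have positive: "F x > 0" if "x \<in> U" "x \<noteq> 0" for x
  proof -
    \<comment> \<open>Positivity outside the disc is negativity inside a disc for the dual:
      \<open>A_dual\<close> inverts \<open>A\<close> up to sign and \<open>P\<close>, so it expands
      \<open>- F\<close> composed with \<open>P\<close> at the rate
      \<open>inverse c\<close>.\<close>
    define F' where "F' x = - F (swap_blocks x)" for x
    let ?S = "{z. 0 < cmod z \<and> cmod z < inverse c}"
    have "neg_inv ?S = {z. cmod z > c}"
      by (simp only: neg_inv_neg_inv flip: neg_inv_outside_disc[OF c(2)])
    then have "x \<in> swap_blocks ` gen_eigenspace A_dual ?S"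
      using swap_gen_eigenspace[of ?S] \<open>x \<in> U\<close> by (simp add: U_def)
    then have "swap_blocks x \<in> gen_eigenspace A_dual ?S"
      by auto
    then have "swap_blocks x \<in> gen_eigenspace A_dual {z. cmod z < inverse c}"
      using gen_eigenspace_mono[of ?S "{z. cmod z < inverse c}"] by blast
    moreover have "isCont F' 0"
    proof -
      have "isCont (\<lambda>x. F (swap_blocks x)) 0"
        by (rule isCont_o2[OF isCont_swap_blocks]) (simp add: swap_blocks_arith F(1))
      then show ?thesis unfolding F'_def by (rule isCont_minus)
    qed
    moreover have "F' (t *\<^sub>R y) = t\<^sup>2 * F' y" for t y
      by (simp add: F'_def scaleR_eq_scalar_mult swap_blocks_arith)
        (simp add: F(2) flip: scaleR_eq_scalar_mult)
    moreover have "(inverse c)\<^sup>2 * F' y < F' (A_dual *v y)" if "y \<noteq> 0" for y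
    proof -
      let ?y = "swap_blocks (A_dual *v y)"
      have "A *v ?y = - swap_blocks y" by (rule A_mult_swap_A_dual)
      moreover from this have "?y \<noteq> 0"
        using that by (metis matrix_vector_mult_0_right neg_equal_0_iff_equal swap_blocks_eq_0_iff)
      moreover have "F (- swap_blocks y) = F (swap_blocks y)"
        using F(2)[of "-1" "swap_blocks y"] by simp
      ultimately have "c\<^sup>2 * F ?y < F (swap_blocks y)" using F(3)[of ?y] by simp
      then show ?thesis using c(2) by (simp add: F'_def field_simps)
    qed
    ultimately have "F' (swap_blocks x) < 0"
      using expanding_form_negative[of "swap_blocks x" A_dual "inverse c" F'] that(2) c(2) by simp
    then show ?thesis by (simp add: F'_def)
  qed
  have subs: "vec.subspace U" "vec.subspace V" "vec.subspace (range ((*v) B))"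
    by (simp_all add: U_def V_def subspace_gen_eigenspace vec.linear_subspace_image[OF matrix_vector_mul_linear_gen])
  have "vec.dim U \<le> rank R"
  proof -
    have "x = 0" if "x \<in> U" "B *v x = 0" for x
      using positive[OF that(1)] F(5)[OF that(2)] by force
    then have "inj_on ((*v) B) U"
      by (simp add: vec.linear_inj_on_iff_eq_0[OF matrix_vector_mul_linear_gen subs(1)])
    then have "vec.dim ((*v) B ` U) = vec.dim U"
      using subs(1)
      by (intro vec.dim_image_eq[OF matrix_vector_mul_linear_gen])
        (simp add: vec.span_eq_iff[THEN iffD2])
    moreover have "vec.dim ((*v) B ` U) \<le> vec.dim (range ((*v) B))"
      by (rule vec.dim_subset) auto
    ultimately show ?thesis by (simp add: dim_range_B)
  qed
  moreover have "vec.dim V + rank R \<le> 2 * CARD('n)"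
  proof -
    let ?W = "range ((*v) B)"
    have "x = 0" if "x \<in> V" "x \<in> ?W" for x
    proof -
      obtain y where "x = B *v y" using \<open>x \<in> ?W\<close> by blast
      then show ?thesis using negative[OF that(1)] F(4)[of y] by force
    qed
    then have "V \<inter> ?W \<subseteq> {0}" by blast
    then have "vec.dim (V \<inter> ?W) = 0" by simp
    moreover have "vec.dim {x + y |x y. x \<in> V \<and> y \<in> ?W} \<le> CARD('n + 'n)"
      by (rule dim_subset_UNIV_cart_gen)
    ultimately show ?thesis
      using vec.dim_sums_Int[OF subs(2,3)] by (simp add: dim_range_B del: vec.dim_eq_0)
  qed
  \<comment> \<open>No eigenvalue has modulus between \<open>omega_max\<close> and \<open>c\<close>,
    nor modulus \<open>c\<close>, so the threshold may be lowered.\<close>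
  moreover have V_eq: "V = gen_eigenspace A {z. cmod z \<le> omega_max \<alpha> \<eta> \<theta>}"
    unfolding V_def gen_eigenspace_Int_spectrum[of A "Collect _"] using c spectrum_gap(1)
    by (intro arg_cong[of _ _ "gen_eigenspace A"]) (force simp: c_def not_le)
  moreover have U_eq: "U = gen_eigenspace A {z. cmod z > omega_max \<alpha> \<eta> \<theta>}"
    unfolding U_def gen_eigenspace_Int_spectrum[of A "Collect _"] using c spectrum_gap(1)
    by (intro arg_cong[of _ _ "gen_eigenspace A"]) (force simp: c_def)
  moreover have "vec.dim U + vec.dim V = 2 * CARD('n)"
  proof -
    let ?S = "{z. cmod z > omega_max \<alpha> \<eta> \<theta>}" and ?T = "{z. cmod z \<le> omega_max \<alpha> \<eta> \<theta>}"
    have ST: "?S \<inter> ?T = {}" "?S \<union> ?T = UNIV" by auto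
    have "direct_sum (gen_eigenspace A UNIV) U V"
      using direct_sum_gen_eigenspace[OF ST(1), of A] unfolding U_eq V_eq ST(2) .
    then have "vec.dim (UNIV :: (complex^('n + 'n)) set) = vec.dim U + vec.dim V"
      unfolding gen_eigenspace_UNIV using dim_direct_sum subs by blast
    then show ?thesis unfolding vec_dim_card by simp
  qed
  ultimately show "vec.dim (gen_eigenspace A {z. cmod z > omega_max \<alpha> \<eta> \<theta>}) = rank R"
    "vec.dim (gen_eigenspace A {z. cmod z \<le> omega_max \<alpha> \<eta> \<theta>}) = 2 * CARD('n) - rank R"
    "rank R \<le> 2 * CARD('n)"
    by simp_all
qed

text \<open>Existence and uniqueness at once, in a form that evaluates the definite descriptions of
  \<open>H_hl\<close> and \<open>H_ll\<close>.\<close>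

lemma is_loss_split_iff:
  "is_loss_split \<alpha> \<eta> \<theta> R \<beta> U V \<longleftrightarrow>
     U = gen_eigenspace A {z. cmod z > omega_max \<alpha> \<eta> \<theta>} \<and>
     V = gen_eigenspace A {z. cmod z \<le> omega_max \<alpha> \<eta> \<theta>}" (is "_ \<longleftrightarrow> U = ?U \<and> V = ?V")
proof -
  let ?S = "{z. cmod z > omega_max \<alpha> \<eta> \<theta>}" and ?T = "{z. cmod z \<le> omega_max \<alpha> \<eta> \<theta>}"
  have ST: "?S \<inter> ?T = {}" "?S \<union> ?T = UNIV" by auto
  have "is_loss_split \<alpha> \<eta> \<theta> R \<beta> ?U ?V"
    using direct_sum_gen_eigenspace[OF ST(1), of A]
    by (simp add: is_loss_split_def invariant_gen_eigenspace spectrum_on_gen_eigenspace sigma0_eq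
        sigma1_eq ST(2) gen_eigenspace_UNIV)
  moreover have "U = ?U \<and> V = ?V" if "is_loss_split \<alpha> \<eta> \<theta> R \<beta> U V"
    using that by (intro spectral_split_unique[OF ST(1)])
      (auto simp: is_loss_split_def sigma0_eq sigma1_eq ST(2) gen_eigenspace_UNIV)
  ultimately show ?thesis by blast
qed

lemma H_hl_eq: "H_hl \<alpha> \<eta> \<theta> R \<beta> = gen_eigenspace A {z. cmod z > omega_max \<alpha> \<eta> \<theta>}"
  and H_ll_eq: "H_ll \<alpha> \<eta> \<theta> R \<beta> = gen_eigenspace A {z. cmod z \<le> omega_max \<alpha> \<eta> \<theta>}"
  unfolding H_hl_def H_ll_def is_loss_split_iff the_pair_eq by simp_all

lemma is_low_loss_split_iff:
  "is_low_loss_split \<alpha> \<eta> \<theta> R \<beta> U V \<longleftrightarrow>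
     U = gen_eigenspace A {z. cmod z < omega_min \<alpha> \<eta> \<theta>} \<and>
     V = gen_eigenspace A {z. omega_min \<alpha> \<eta> \<theta> \<le> cmod z \<and> cmod z \<le> omega_max \<alpha> \<eta> \<theta>}"
  (is "_ \<longleftrightarrow> U = ?U \<and> V = ?V")
proof -
  let ?S = "{z. cmod z < omega_min \<alpha> \<eta> \<theta>}"
    and ?T = "{z. omega_min \<alpha> \<eta> \<theta> \<le> cmod z \<and> cmod z \<le> omega_max \<alpha> \<eta> \<theta>}"
  have ST: "?S \<inter> ?T = {}" "?S \<union> ?T = {z. cmod z \<le> omega_max \<alpha> \<eta> \<theta>}"
    using omega_min_le_omega_max by auto
  have "is_low_loss_split \<alpha> \<eta> \<theta> R \<beta> ?U ?V"
    using direct_sum_gen_eigenspace[OF ST(1), of A]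
    by (simp add: is_low_loss_split_def invariant_gen_eigenspace spectrum_on_gen_eigenspace
        H_ll_eq ST(2))
  moreover have "U = ?U \<and> V = ?V" if "is_low_loss_split \<alpha> \<eta> \<theta> R \<beta> U V"
    using that by (intro spectral_split_unique[OF ST(1)])
      (auto simp: is_low_loss_split_def H_ll_eq ST(2))
  ultimately show ?thesis by blast
qed

lemma H_ll0_eq: "H_ll0 \<alpha> \<eta> \<theta> R \<beta> = gen_eigenspace A {z. cmod z < omega_min \<alpha> \<eta> \<theta>}"
  and H_ll1_eq: "H_ll1 \<alpha> \<eta> \<theta> R \<beta> =
    gen_eigenspace A {z. omega_min \<alpha> \<eta> \<theta> \<le> cmod z \<and> cmod z \<le> omega_max \<alpha> \<eta> \<theta>}"
  unfolding H_ll0_def H_ll1_def is_low_loss_split_iff the_pair_eq by simp_all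

end

text \<open>The threshold conditions compared under inversion agree only away from 0, because of the
  convention \<open>inverse 0 = 0\<close>.\<close>

lemma Int_spectrum_cong:
  assumes "0 \<notin> X" "\<And>z. z \<noteq> 0 \<Longrightarrow> P (cmod z) \<longleftrightarrow> Q (cmod z)"
  shows "X \<inter> {z. P (cmod z)} = X \<inter> {z. Q (cmod z)}"
proof -
  have "P (cmod z) \<longleftrightarrow> Q (cmod z)" if "z \<in> X" for z
    using that assms(1) by (intro assms(2)) auto
  then show ?thesis by auto
qed

text \<open>\<open>P\<close> maps the dual high-loss subspace onto \<open>H_ll0\<close>; the
  dimension of \<open>H_ll1\<close> is what remains of \<open>H_ll\<close>. Integers are used so
  that the difference is not truncated.\<close>

lemma (in overdamped) dim_H_ll0_H_ll1:
  assumes dual: "overdamped \<eta> \<alpha> \<theta> R \<beta>"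
  shows "vec.dim (H_ll0 \<alpha> \<eta> \<theta> R \<beta>) = rank R"
    and "int (vec.dim (H_ll1 \<alpha> \<eta> \<theta> R \<beta>)) = 2 * int CARD('n) - 2 * int (rank R)"
proof -
  let ?w = "omega_max \<eta> \<alpha> \<theta>"
  have "?w > 0" by (rule pencil.omega_max_pos[OF pencil.dual[OF pencil_axioms]])
  \<comment> \<open>Inversion yields a punctured disc of radius \<open>omega_min\<close>. The
    puncture disappears because 0 is not in the spectrum of \<open>A\<close>.\<close>
  then have "gen_eigenspace A (neg_inv {z. cmod z > ?w}) = H_ll0 \<alpha> \<eta> \<theta> R \<beta>"
    unfolding H_ll0_eq neg_inv_outside_disc[OF \<open>?w > 0\<close>] gen_eigenspace_Int_spectrum[of A "Collect _"]
    using zero_notin_spectrum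
    by (intro arg_cong[of _ _ "gen_eigenspace A"]) (auto simp: omega_min_eq)
  then show dim0: "vec.dim (H_ll0 \<alpha> \<eta> \<theta> R \<beta>) = rank R"
    using dim_gen_eigenspace_dual[of "{z. cmod z > ?w}"] \<open>?w > 0\<close>
      overdamped.dim_spectral_subspaces(1)[OF dual] by simp
  have "is_low_loss_split \<alpha> \<eta> \<theta> R \<beta> (H_ll0 \<alpha> \<eta> \<theta> R \<beta>) (H_ll1 \<alpha> \<eta> \<theta> R \<beta>)"
    by (simp add: is_low_loss_split_iff H_ll0_eq H_ll1_eq)
  then have "vec.dim (H_ll \<alpha> \<eta> \<theta> R \<beta>) =
      vec.dim (H_ll0 \<alpha> \<eta> \<theta> R \<beta>) + vec.dim (H_ll1 \<alpha> \<eta> \<theta> R \<beta>)"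
    by (intro dim_direct_sum) (auto simp: is_low_loss_split_def invariant_subspace_def)
  then show "int (vec.dim (H_ll1 \<alpha> \<eta> \<theta> R \<beta>)) = 2 * int CARD('n) - 2 * int (rank R)"
    using dim0 dim_spectral_subspaces(2,3) by (simp add: H_ll_eq)
qed

text \<open>Each \<open>omega_min\<close> is the reciprocal of the other \<open>omega_max\<close>,
  so inversion exchanges the innermost and outermost regions and maps the middle annulus to the dual
  one, boundaries included.\<close>

lemma (in overdamped) spectra_dual:
  assumes dual: "overdamped \<eta> \<alpha> \<theta> R \<beta>"
  shows "spectrum_on A (H_ll0 \<alpha> \<eta> \<theta> R \<beta>) = neg_inv (spectrum_on A_dual (H_hl \<eta> \<alpha> \<theta> R \<beta>))"
    and "spectrum_on A (H_hl \<alpha> \<eta> \<theta> R \<beta>) = neg_inv (spectrum_on A_dual (H_ll0 \<eta> \<alpha> \<theta> R \<beta>))"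
    and "spectrum_on A (H_ll1 \<alpha> \<eta> \<theta> R \<beta>) = neg_inv (spectrum_on A_dual (H_ll1 \<eta> \<alpha> \<theta> R \<beta>))"
proof -
  have pd: "pencil \<eta> \<alpha> \<theta> R" by (rule pencil.dual[OF pencil_axioms])
  have pos: "omega_max \<alpha> \<eta> \<theta> > 0" "omega_max \<eta> \<alpha> \<theta> > 0"
    by (rule omega_max_pos pencil.omega_max_pos[OF pd])+
  note eqs = spectrum_on_gen_eigenspace H_ll0_eq H_ll1_eq H_hl_eq overdamped.H_ll0_eq[OF dual]
    overdamped.H_ll1_eq[OF dual] overdamped.H_hl_eq[OF dual]
    neg_inv_Int_cmod[of _ "\<lambda>t. t > omega_max \<eta> \<alpha> \<theta>"]
    neg_inv_Int_cmod[of _ "\<lambda>t. t < inverse (omega_max \<alpha> \<eta> \<theta>)"]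
    neg_inv_Int_cmod[of _ "\<lambda>t. inverse (omega_max \<alpha> \<eta> \<theta>) \<le> t \<and> t \<le> omega_max \<eta> \<alpha> \<theta>"]
    spectrum_eq_neg_inv[symmetric] omega_min_eq pencil.omega_min_eq[OF pd]
  show "spectrum_on A (H_ll0 \<alpha> \<eta> \<theta> R \<beta>) = neg_inv (spectrum_on A_dual (H_hl \<eta> \<alpha> \<theta> R \<beta>))"
    unfolding eqs using pos by (intro Int_spectrum_cong zero_notin_spectrum) (auto simp: field_simps)
  show "spectrum_on A (H_hl \<alpha> \<eta> \<theta> R \<beta>) = neg_inv (spectrum_on A_dual (H_ll0 \<eta> \<alpha> \<theta> R \<beta>))"
    unfolding eqs using pos by (intro Int_spectrum_cong zero_notin_spectrum) (auto simp: field_simps)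
  show "spectrum_on A (H_ll1 \<alpha> \<eta> \<theta> R \<beta>) = neg_inv (spectrum_on A_dual (H_ll1 \<eta> \<alpha> \<theta> R \<beta>))"
    unfolding eqs using pos by (intro Int_spectrum_cong zero_notin_spectrum) (auto simp: field_simps)
qed

lemma (in overdamped) spectra_neg_cnj:
  "spectrum_on A (H_ll0 \<alpha> \<eta> \<theta> R \<beta>) = neg_cnj (spectrum_on A (H_ll0 \<alpha> \<eta> \<theta> R \<beta>))"
  "spectrum_on A (H_hl \<alpha> \<eta> \<theta> R \<beta>) = neg_cnj (spectrum_on A (H_hl \<alpha> \<eta> \<theta> R \<beta>))"
  "spectrum_on A (H_ll1 \<alpha> \<eta> \<theta> R \<beta>) = neg_cnj (spectrum_on A (H_ll1 \<alpha> \<eta> \<theta> R \<beta>))"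
  unfolding H_ll0_eq H_hl_eq H_ll1_eq spectrum_on_gen_eigenspace
    neg_cnj_Int_cmod[of _ "\<lambda>t. t < omega_min \<alpha> \<eta> \<theta>"]
    neg_cnj_Int_cmod[of _ "\<lambda>t. t > omega_max \<alpha> \<eta> \<theta>"]
    neg_cnj_Int_cmod[of _ "\<lambda>t. omega_min \<alpha> \<eta> \<theta> \<le> t \<and> t \<le> omega_max \<alpha> \<eta> \<theta>"]
    spectrum_eq_neg_cnj[symmetric]
  by (rule refl)+

lemma (in overdamped) zero_notin_spectrum_on:
  "0 \<notin> spectrum_on A (H_hl \<alpha> \<eta> \<theta> R \<beta>)"
  "0 \<notin> spectrum_on A (H_ll0 \<alpha> \<eta> \<theta> R \<beta>)"
  "0 \<notin> spectrum_on A (H_ll1 \<alpha> \<eta> \<theta> R \<beta>)"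
  using zero_notin_spectrum
  by (auto simp: H_ll0_eq H_hl_eq H_ll1_eq spectrum_on_gen_eigenspace)

theorem theorem28:
  fixes \<alpha> \<eta> \<theta> R :: "real^'n^'n" and \<beta> :: real
  assumes "pos_def \<alpha>" and "pos_semidef \<eta>" and "transpose \<theta> = - \<theta>" and "pos_semidef R"
    and "rank R > 0" and "\<beta> \<ge> 0"
    and "pos_def \<eta>"
    and "\<beta> > max (2 * (omega_max \<alpha> \<eta> \<theta> / b_min \<alpha> R)) (2 * (omega_max \<eta> \<alpha> \<theta> / b_min \<eta> R))"
  shows "(\<exists>!(U, V). is_low_loss_split \<alpha> \<eta> \<theta> R \<beta> U V) \<and>
    is_low_loss_split \<alpha> \<eta> \<theta> R \<beta> (H_ll0 \<alpha> \<eta> \<theta> R \<beta>) (H_ll1 \<alpha> \<eta> \<theta> R \<beta>) \<and>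
    vec.dim (H_ll0 \<alpha> \<eta> \<theta> R \<beta>) = rank R \<and>
    int (vec.dim (H_ll1 \<alpha> \<eta> \<theta> R \<beta>)) = 2 * int CARD('n) - 2 * int (rank R) \<and>
    spectrum_on (Amat \<alpha> \<eta> \<theta> R \<beta>) (H_ll0 \<alpha> \<eta> \<theta> R \<beta>) =
      neg_cnj (spectrum_on (Amat \<alpha> \<eta> \<theta> R \<beta>) (H_ll0 \<alpha> \<eta> \<theta> R \<beta>)) \<and>
    0 \<notin> spectrum_on (Amat \<eta> \<alpha> \<theta> R \<beta>) (H_hl \<eta> \<alpha> \<theta> R \<beta>) \<and>
    spectrum_on (Amat \<alpha> \<eta> \<theta> R \<beta>) (H_ll0 \<alpha> \<eta> \<theta> R \<beta>) =
      neg_inv (spectrum_on (Amat \<eta> \<alpha> \<theta> R \<beta>) (H_hl \<eta> \<alpha> \<theta> R \<beta>)) \<and>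
    spectrum_on (Amat \<alpha> \<eta> \<theta> R \<beta>) (H_hl \<alpha> \<eta> \<theta> R \<beta>) =
      neg_cnj (spectrum_on (Amat \<alpha> \<eta> \<theta> R \<beta>) (H_hl \<alpha> \<eta> \<theta> R \<beta>)) \<and>
    0 \<notin> spectrum_on (Amat \<eta> \<alpha> \<theta> R \<beta>) (H_ll0 \<eta> \<alpha> \<theta> R \<beta>) \<and>
    spectrum_on (Amat \<alpha> \<eta> \<theta> R \<beta>) (H_hl \<alpha> \<eta> \<theta> R \<beta>) =
      neg_inv (spectrum_on (Amat \<eta> \<alpha> \<theta> R \<beta>) (H_ll0 \<eta> \<alpha> \<theta> R \<beta>)) \<and>
    spectrum_on (Amat \<alpha> \<eta> \<theta> R \<beta>) (H_ll1 \<alpha> \<eta> \<theta> R \<beta>) =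
      neg_cnj (spectrum_on (Amat \<alpha> \<eta> \<theta> R \<beta>) (H_ll1 \<alpha> \<eta> \<theta> R \<beta>)) \<and>
    0 \<notin> spectrum_on (Amat \<eta> \<alpha> \<theta> R \<beta>) (H_ll1 \<eta> \<alpha> \<theta> R \<beta>) \<and>
    spectrum_on (Amat \<alpha> \<eta> \<theta> R \<beta>) (H_ll1 \<alpha> \<eta> \<theta> R \<beta>) =
      neg_inv (spectrum_on (Amat \<eta> \<alpha> \<theta> R \<beta>) (H_ll1 \<eta> \<alpha> \<theta> R \<beta>))"
proof -
  \<comment> \<open>The maximum in the assumption on \<open>\<beta>\<close> supplies the bound for
    both members of the dual pair.\<close>
  have primal: "overdamped \<alpha> \<eta> \<theta> R \<beta>" and dual_overdamped: "overdamped \<eta> \<alpha> \<theta> R \<beta>"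
    using assms by unfold_locales auto
  interpret overdamped \<alpha> \<eta> \<theta> R \<beta> by (rule primal)
  have ex1: "\<exists>!(U, V). is_low_loss_split \<alpha> \<eta> \<theta> R \<beta> U V"
    unfolding is_low_loss_split_iff by auto
  have split: "is_low_loss_split \<alpha> \<eta> \<theta> R \<beta> (H_ll0 \<alpha> \<eta> \<theta> R \<beta>) (H_ll1 \<alpha> \<eta> \<theta> R \<beta>)"
    by (simp add: is_low_loss_split_iff H_ll0_eq H_ll1_eq)
  show ?thesis
    by (intro conjI ex1 split dim_H_ll0_H_ll1[OF dual_overdamped] spectra_neg_cnj spectra_dual[OF dual_overdamped]
        overdamped.zero_notin_spectrum_on[OF dual_overdamped])
qed

end
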